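(* Let $(M,g)$ be a compact Einstein manifold of even dimension $n\ge4$ (any signature) which is not Ricci flat, with Einstein scale $\sigma$, and let $k\in\{0,1,\dots,\frac n2\}$. The quadratic form $\tilde\Theta:\mathcal H^k_G\times\mathcal H^k_G\to\mathbb R$, $\tilde\Theta(u,w)=\langle u,Q_k^\sigma w\rangle$, descends (via the projection $\mathcal H^k_G\to\mathcal H^k_\sigma$ of the direct sum $\mathcal H_G^k=\mathcal H^k_\sigma\oplus\bigoplus_{i=1}^{(n-2k)/2}\overline{\mathcal H}^k_{\sigma,\lambda_i^k}$) to $$\mathcal H^k_\sigma\times\mathcal H^k_\sigma\to\mathbb R,\qquad(u,w)\mapsto s^kJ^{\frac{n-2k}{2}}\langle u,w\rangle,$$ where $s^k=\prod_{i=1}^{\frac{n-2k}{2}}\frac{2i(n-2k-i+1)}{n}$ (so $s^{n/2}=1$).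
   Context: $J=\mathrm{Sc}/(2(n-1))$ is the trace of the Schouten tensor of $g$; constant and nonzero. $\sigma$ is the density with $g=\sigma^{-2}\boldsymbol g$ ($\boldsymbol g$ the conformal metric); it is used to trivialise density bundles, so that $\mathcal E^k$ (smooth $k$-forms) and $\mathcal E_k=\mathcal E^k[2k-n]$ are both identified with the space of smooth $k$-forms; $\mathcal E_{-1}:=0$. $d$ is the exterior derivative, $\delta$ its formal adjoint with respect to $g$, $\mathcal C^k$ the closed $k$-forms, $\mathcal N$ denotes null space. $\langle\varphi,\psi\rangle=\int_M\varphi\cdot\psi\,d\mu$ is the conformally invariant pairing of $\mathcal E^k$ with $\mathcal E_k$, where $\varphi\cdot\psi$ is the complete contraction by the conformal metric. Definitions (empty products are the identity): $$Q_k^\sigma=\prod_{i=1}^{\frac{n-2k}{2}}\Big(d\delta+\tfrac{2i(n-2k-i+1)}{n}J\Big):\mathcal C^k\to\mathcal E_k,\qquad\mathcal H^k_G=\{f\in\mathcal C^k\mid\delta Q_k^\sigma f=0\},$$ $$\mathcal H^k_\sigma=\mathcal N(d)\cap\mathcal N(\delta)\subset\mathcal E^k,\quad\overline{\mathcal H}^k_{\sigma,\lambda}=\{f\in\mathcal E^k\mid d\delta f=\lambda f\},\quad\lambda_i^k=-\tfrac{2i(n-2k-i+1)}{n}J .$$ *)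

theory Defs
  imports "HOL-Analysis.Analysis" "HOL-Library.Function_Algebras"
begin

text \<open>Real-valued fields are functions; they form a real vector space pointwise.\<close>

instantiation "fun" :: (type, real_vector) real_vector
begin

definition scaleR_fun :: "real \<Rightarrow> ('a \<Rightarrow> 'b) \<Rightarrow> 'a \<Rightarrow> 'b"
  where "scaleR_fun r f = (\<lambda>x. r *\<^sub>R f x)"

instance
  by standard (auto simp: scaleR_fun_def fun_eq_iff algebra_simps)

end


section \<open>Smooth manifolds and tensor components in charts\<close>

text \<open>A chart is a domain together with a coordinate map; the dimension is \<open>CARD('n)\<close>.\<close>

type_synonym ('a, 'n) chart = "'a set \<times> ('a \<Rightarrow> real ^ 'n)"

abbreviation chart_dom :: "('a, 'n) chart \<Rightarrow> 'a set"
  where "chart_dom c \<equiv> fst c"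

abbreviation coords :: "('a, 'n) chart \<Rightarrow> 'a \<Rightarrow> real ^ 'n"
  where "coords c \<equiv> snd c"

abbreviation uncoords :: "('a, 'n) chart \<Rightarrow> real ^ 'n \<Rightarrow> 'a"
  where "uncoords c \<equiv> inv_into (chart_dom c) (coords c)"

definition partial_deriv :: "'n::finite \<Rightarrow> (real ^ 'n \<Rightarrow> real) \<Rightarrow> real ^ 'n \<Rightarrow> real"
  where "partial_deriv i f x = frechet_derivative f (at x) (axis i 1)"

text \<open>\<open>Ck_on r S f\<close>: on the open set \<open>S\<close>, \<open>f\<close> is \<open>r\<close> times continuously differentiable.\<close>

primrec Ck_on :: "nat \<Rightarrow> (real ^ 'n::finite) set \<Rightarrow> (real ^ 'n \<Rightarrow> real) \<Rightarrow> bool"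
  where
    "Ck_on 0 S f \<longleftrightarrow> continuous_on S f"
  | "Ck_on (Suc r) S f \<longleftrightarrow> f differentiable_on S \<and> (\<forall>i. Ck_on r S (partial_deriv i f))"

definition smooth_on :: "(real ^ 'n::finite) set \<Rightarrow> (real ^ 'n \<Rightarrow> real) \<Rightarrow> bool"
  where "smooth_on S f \<longleftrightarrow> (\<forall>r. Ck_on r S f)"

text \<open>The carrier of the manifold is the whole type \<open>'a\<close>. The Hausdorff and countability
  requirements are imposed by the type class.\<close>

definition smooth_atlas ::
    "('a::{t2_space, second_countable_topology}, 'n::finite) chart set \<Rightarrow> bool"
  where "smooth_atlas A \<longleftrightarrow>
    (\<Union>c\<in>A. chart_dom c) = UNIV \<and>
    (\<forall>c\<in>A. open (chart_dom c) \<and> open (coords c ` chart_dom c) \<and>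
       homeomorphism (chart_dom c) (coords c ` chart_dom c) (coords c) (uncoords c)) \<and>
    (\<forall>c\<in>A. \<forall>c'\<in>A. \<forall>i.
       smooth_on (coords c ` (chart_dom c \<inter> chart_dom c')) (\<lambda>x. coords c' (uncoords c x) $ i))"

definition chart_pd :: "('a, 'n::finite) chart \<Rightarrow> 'n \<Rightarrow> ('a \<Rightarrow> real) \<Rightarrow> 'a \<Rightarrow> real"
  where "chart_pd c i f p = partial_deriv i (\<lambda>x. f (uncoords c x)) (coords c p)"

text \<open>Row \<open>i\<close>, column \<open>j\<close>: derivative of the \<open>i\<close>-th \<open>c'\<close>-coordinate along the \<open>j\<close>-th
  \<open>c\<close>-coordinate.\<close>

definition jac :: "('a, 'n::finite) chart \<Rightarrow> ('a, 'n) chart \<Rightarrow> 'a \<Rightarrow> real ^ 'n ^ 'n"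
  where "jac c c' p = (\<chi> i j. chart_pd c j (\<lambda>q. coords c' q $ i) p)"


section \<open>Pseudo-Riemannian metrics and curvature\<close>

text \<open>A metric is given by its matrix \<open>g c p\<close> in every chart \<open>c\<close> at every \<open>p \<in> chart_dom c\<close>.
  Any signature is allowed.\<close>

type_synonym ('a, 'n) metric_field = "('a, 'n) chart \<Rightarrow> 'a \<Rightarrow> real ^ 'n ^ 'n"

definition pseudo_riemannian_metric ::
    "('a, 'n::finite) chart set \<Rightarrow> ('a, 'n) metric_field \<Rightarrow> bool"
  where "pseudo_riemannian_metric A g \<longleftrightarrow>
    (\<forall>c\<in>A. \<forall>i j. smooth_on (coords c ` chart_dom c) (\<lambda>x. g c (uncoords c x) $ i $ j)) \<and>
    (\<forall>c\<in>A. \<forall>p\<in>chart_dom c. transpose (g c p) = g c p \<and> invertible (g c p)) \<and>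
    (\<forall>c\<in>A. \<forall>c'\<in>A. \<forall>p\<in>chart_dom c \<inter> chart_dom c'.
       g c p = transpose (jac c c' p) ** g c' p ** jac c c' p)"

abbreviation ginv :: "('a, 'n::finite) metric_field \<Rightarrow> ('a, 'n) chart \<Rightarrow> 'a \<Rightarrow> real ^ 'n ^ 'n"
  where "ginv g c p \<equiv> matrix_inv (g c p)"

text \<open>\<open>christoffel g c a b d p\<close> is $\Gamma^a{}_{bd}$ of the Levi-Civita connection.\<close>

definition christoffel ::
    "('a, 'n::finite) metric_field \<Rightarrow> ('a, 'n) chart \<Rightarrow> 'n \<Rightarrow> 'n \<Rightarrow> 'n \<Rightarrow> 'a \<Rightarrow> real"
  where "christoffel g c a b d p =
    (1/2) * (\<Sum>e\<in>UNIV. ginv g c p $ a $ e *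
      (chart_pd c b (\<lambda>q. g c q $ d $ e) p + chart_pd c d (\<lambda>q. g c q $ b $ e) p
        - chart_pd c e (\<lambda>q. g c q $ b $ d) p))"

text \<open>\<open>riemann g c a b e d p\<close> is $R_{ab}{}^e{}_d$, where
  $(\nabla_a\nabla_b - \nabla_b\nabla_a) V^e = R_{ab}{}^e{}_d V^d$.\<close>

definition riemann ::
    "('a, 'n::finite) metric_field \<Rightarrow> ('a, 'n) chart \<Rightarrow> 'n \<Rightarrow> 'n \<Rightarrow> 'n \<Rightarrow> 'n \<Rightarrow> 'a \<Rightarrow> real"
  where "riemann g c a b e d p =
    chart_pd c a (christoffel g c e b d) p - chart_pd c b (christoffel g c e a d) p
    + (\<Sum>f\<in>UNIV. christoffel g c e a f p * christoffel g c f b d p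
                - christoffel g c e b f p * christoffel g c f a d p)"

definition ricci :: "('a, 'n::finite) metric_field \<Rightarrow> ('a, 'n) metric_field"
  where "ricci g c p = (\<chi> b d. \<Sum>a\<in>UNIV. riemann g c a b a d p)"

definition scalar_curvature ::
    "('a, 'n::finite) metric_field \<Rightarrow> ('a, 'n) chart \<Rightarrow> 'a \<Rightarrow> real"
  where "scalar_curvature g c p =
    (\<Sum>a\<in>UNIV. \<Sum>b\<in>UNIV. ginv g c p $ a $ b * ricci g c p $ a $ b)"

definition schouten_trace ::
    "('a, 'n::finite) metric_field \<Rightarrow> ('a, 'n) chart \<Rightarrow> 'a \<Rightarrow> real"
  where "schouten_trace g c p = scalar_curvature g c p / (2 * (real CARD('n) - 1))"

definition einstein :: "('a, 'n::finite) chart set \<Rightarrow> ('a, 'n) metric_field \<Rightarrow> bool"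
  where "einstein A g \<longleftrightarrow>
    (\<exists>l::real. \<forall>c\<in>A. \<forall>p\<in>chart_dom c. ricci g c p = l *\<^sub>R g c p)"

definition ricci_flat :: "('a, 'n::finite) chart set \<Rightarrow> ('a, 'n) metric_field \<Rightarrow> bool"
  where "ricci_flat A g \<longleftrightarrow> (\<forall>c\<in>A. \<forall>p\<in>chart_dom c. ricci g c p = 0)"

text \<open>The volume measure $d\mu = \sqrt{|\det g|}\,dx$; this determines it uniquely, and no
  orientation is needed.\<close>

definition volume_measure ::
    "('a::{t2_space, second_countable_topology}, 'n::finite) chart set \<Rightarrow>
     ('a, 'n) metric_field \<Rightarrow> 'a measure \<Rightarrow> bool"
  where "volume_measure A g \<mu> \<longleftrightarrow>
    sets \<mu> = sets borel \<and>
    (\<forall>c\<in>A. \<forall>B\<in>sets borel. B \<subseteq> chart_dom c \<longrightarrow>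
       emeasure \<mu> B =
         (\<integral>\<^sup>+x\<in>coords c ` B. ennreal (sqrt \<bar>det (g c (uncoords c x))\<bar>) \<partial>lborel))"


section \<open>Differential forms\<close>

text \<open>\<open>\<omega> c p [i\<^sub>1, \<dots>, i\<^sub>k]\<close> is the component $\omega_{i_1\dots i_k}$ at \<open>p\<close> in the chart \<open>c\<close>.
  Outside its proper range of arguments a form has the value 0, so that two
  forms are equal iff they are equal as functions.\<close>

type_synonym ('a, 'n) field = "('a, 'n) chart \<Rightarrow> 'a \<Rightarrow> 'n list \<Rightarrow> real"

definition forms :: "('a, 'n::finite) chart set \<Rightarrow> nat \<Rightarrow> ('a, 'n) field set"
  where "forms A k = {\<omega>.
    (\<forall>c p I. \<not> (c \<in> A \<and> p \<in> chart_dom c \<and> length I = k) \<longrightarrow> \<omega> c p I = 0) \<and>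
    (\<forall>c\<in>A. \<forall>I. smooth_on (coords c ` chart_dom c) (\<lambda>x. \<omega> c (uncoords c x) I)) \<and>
    (\<forall>c\<in>A. \<forall>p\<in>chart_dom c. \<forall>I. \<forall>s<length I. \<forall>r<s.
       \<omega> c p (I[r := I ! s, s := I ! r]) = - \<omega> c p I) \<and>
    (\<forall>c\<in>A. \<forall>c'\<in>A. \<forall>p\<in>chart_dom c \<inter> chart_dom c'. \<forall>I. length I = k \<longrightarrow>
       \<omega> c p I =
         (\<Sum>L | length L = k. (\<Prod>r<k. jac c c' p $ (L ! r) $ (I ! r)) * \<omega> c' p L))}"

definition ext_deriv ::
    "('a, 'n::finite) chart set \<Rightarrow> ('a, 'n) field \<Rightarrow> ('a, 'n) field"
  where "ext_deriv A \<omega> c p I =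
    (if c \<in> A \<and> p \<in> chart_dom c
     then \<Sum>j<length I.
       (-1) ^ j * chart_pd c (I ! j) (\<lambda>q. \<omega> c q (take j I @ drop (Suc j) I)) p
     else 0)"

definition closed_forms :: "('a, 'n::finite) chart set \<Rightarrow> nat \<Rightarrow> ('a, 'n) field set"
  where "closed_forms A k = {\<omega> \<in> forms A k. ext_deriv A \<omega> = 0}"

text \<open>The complete contraction
  $g^{i_1 j_1} \cdots g^{i_k j_k} \varphi_{i_1 \dots i_k} \psi_{j_1 \dots j_k}$ (without a factor
  $1/k!$). It does not depend on the chart, so some chart around \<open>p\<close> is chosen.\<close>

definition contraction ::
    "('a, 'n::finite) chart set \<Rightarrow> ('a, 'n) metric_field \<Rightarrow> nat \<Rightarrow>
     ('a, 'n) field \<Rightarrow> ('a, 'n) field \<Rightarrow> 'a \<Rightarrow> real"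
  where "contraction A g k \<phi> \<psi> p =
    (let c = (SOME c. c \<in> A \<and> p \<in> chart_dom c) in
     \<Sum>I | length I = k. \<Sum>L | length L = k.
       (\<Prod>r<k. ginv g c p $ (I ! r) $ (L ! r)) * \<phi> c p I * \<psi> c p L)"

text \<open>The pairing of $k$-forms with weighted $k$-forms, where the latter are identified with
  $k$-forms by means of the scale of \<open>g\<close>.\<close>

definition pairing ::
    "('a, 'n::finite) chart set \<Rightarrow> ('a, 'n) metric_field \<Rightarrow> 'a measure \<Rightarrow> nat \<Rightarrow>
     ('a, 'n) field \<Rightarrow> ('a, 'n) field \<Rightarrow> real"
  where "pairing A g \<mu> k \<phi> \<psi> = (LINT p|\<mu>. contraction A g k \<phi> \<psi> p)"

text \<open>\<open>\<delta>\<close> is the formal adjoint of the exterior derivative, in all degrees at once. As usual the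
  inner product on $k$-forms is $\frac{1}{k!}$ times the complete contraction, so that
  $(\delta\varphi)_{a_2 \dots a_k} = -\nabla^{a_1} \varphi_{a_1 \dots a_k}$. There are no forms of
  degree $-1$, so \<open>\<delta>\<close> vanishes on functions.\<close>

definition codifferential ::
    "('a, 'n::finite) chart set \<Rightarrow> ('a, 'n) metric_field \<Rightarrow> 'a measure \<Rightarrow>
     (('a, 'n) field \<Rightarrow> ('a, 'n) field) \<Rightarrow> bool"
  where "codifferential A g \<mu> \<delta> \<longleftrightarrow>
    (\<forall>\<psi>\<in>forms A 0. \<delta> \<psi> = 0) \<and>
    (\<forall>k. \<forall>\<psi>\<in>forms A (Suc k). \<delta> \<psi> \<in> forms A k) \<and>
    (\<forall>k. \<forall>\<phi>\<in>forms A k. \<forall>\<psi>\<in>forms A k. \<forall>a b.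
       \<delta> (a *\<^sub>R \<phi> + b *\<^sub>R \<psi>) = a *\<^sub>R \<delta> \<phi> + b *\<^sub>R \<delta> \<psi>) \<and>
    (\<forall>k. \<forall>\<phi>\<in>forms A k. \<forall>\<psi>\<in>forms A (Suc k).
       pairing A g \<mu> (Suc k) (ext_deriv A \<phi>) \<psi> / fact (Suc k)
         = pairing A g \<mu> k \<phi> (\<delta> \<psi>) / fact k)"


section \<open>Q-operators and the associated spaces\<close>

text \<open>In this section \<open>n\<close> is the dimension and \<open>2 * k \<le> n\<close>.\<close>

definition coef :: "nat \<Rightarrow> nat \<Rightarrow> nat \<Rightarrow> real"
  where "coef n k i = 2 * real i * (real n - 2 * real k - real i + 1) / real n"

definition Q_op ::
    "('a, 'n::finite) chart set \<Rightarrow> (('a, 'n) field \<Rightarrow> ('a, 'n) field) \<Rightarrow> real \<Rightarrow> nat \<Rightarrow>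
     ('a, 'n) field \<Rightarrow> ('a, 'n) field"
  where "Q_op A \<delta> J k =
    foldr (\<lambda>i F. (\<lambda>f. ext_deriv A (\<delta> f) + (coef CARD('n) k i * J) *\<^sub>R f) \<circ> F)
      [1..<Suc ((CARD('n) - 2 * k) div 2)] id"

definition H_G ::
    "('a, 'n::finite) chart set \<Rightarrow> (('a, 'n) field \<Rightarrow> ('a, 'n) field) \<Rightarrow> real \<Rightarrow> nat \<Rightarrow>
     ('a, 'n) field set"
  where "H_G A \<delta> J k = {f \<in> closed_forms A k. \<delta> (Q_op A \<delta> J k f) = 0}"

definition H_harm ::
    "('a, 'n::finite) chart set \<Rightarrow> (('a, 'n) field \<Rightarrow> ('a, 'n) field) \<Rightarrow> nat \<Rightarrow>
     ('a, 'n) field set"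
  where "H_harm A \<delta> k = {f \<in> forms A k. ext_deriv A f = 0 \<and> \<delta> f = 0}"

definition H_eig ::
    "('a, 'n::finite) chart set \<Rightarrow> (('a, 'n) field \<Rightarrow> ('a, 'n) field) \<Rightarrow> nat \<Rightarrow> real \<Rightarrow>
     ('a, 'n) field set"
  where "H_eig A \<delta> k l = {f \<in> forms A k. ext_deriv A (\<delta> f) = l *\<^sub>R f}"

text \<open>The summands of \<open>H_G\<close>: index 0 is the harmonic space, index \<open>i \<ge> 1\<close> the eigenspace
  for $\lambda_i^k$.\<close>

definition summand ::
    "('a, 'n::finite) chart set \<Rightarrow> (('a, 'n) field \<Rightarrow> ('a, 'n) field) \<Rightarrow> real \<Rightarrow> nat \<Rightarrow> nat \<Rightarrow>
     ('a, 'n) field set"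
  where "summand A \<delta> J k i =
    (if i = 0 then H_harm A \<delta> k else H_eig A \<delta> k (- coef CARD('n) k i * J))"


section \<open>Direct sums and descent of forms\<close>

definition direct_sum :: "'v::real_vector set \<Rightarrow> 'i set \<Rightarrow> ('i \<Rightarrow> 'v set) \<Rightarrow> bool"
  where "direct_sum V I W \<longleftrightarrow>
    finite I \<and> subspace V \<and> (\<forall>i\<in>I. subspace (W i) \<and> W i \<subseteq> V) \<and>
    (\<forall>v\<in>V. \<exists>!w. w \<in> Pi\<^sub>E I W \<and> v = sum w I)"

text \<open>Meaningful for \<open>v \<in> V\<close> and \<open>i \<in> I\<close> if \<open>direct_sum V I W\<close>.\<close>

definition sum_projection :: "'i set \<Rightarrow> ('i \<Rightarrow> 'v::real_vector set) \<Rightarrow> 'i \<Rightarrow> 'v \<Rightarrow> 'v"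
  where "sum_projection I W i v = (THE w. w \<in> Pi\<^sub>E I W \<and> v = sum w I) i"

definition descends_via ::
    "('v \<Rightarrow> 'w) \<Rightarrow> 'v set \<Rightarrow> 'w set \<Rightarrow> ('v \<Rightarrow> 'v \<Rightarrow> real) \<Rightarrow> ('w \<Rightarrow> 'w \<Rightarrow> real) \<Rightarrow> bool"
  where "descends_via P V W B B' \<longleftrightarrow>
    P ` V = W \<and> (\<forall>u\<in>V. \<forall>w\<in>V. B u w = B' (P u) (P w))"

end

theory Submission
  imports Defs
begin

text \<open>
  Write \<open>d\<close> for the exterior derivative and \<open>T = d \<delta>\<close>. On closed \<open>k\<close>-forms \<open>T\<close> is an
  endomorphism, and the operator \<open>Q\<close> of the theorem is the product of the commuting factors
  \<open>T + b\<^sub>i\<close>, \<open>1 \<le> i \<le> (n - 2k)/2\<close>, with \<open>b\<^sub>i = coef n k i * J\<close>. Since the metric is Einstein and not Ricci flat, \<open>J \<noteq> 0\<close>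
  (\<open>schouten_trace_nonzero\<close>), and since \<open>i \<mapsto> i (n - 2k - i + 1)\<close> increases strictly for
  \<open>0 \<le> i \<le> (n - 2k)/2\<close> (\<open>coef_strict_mono\<close>), the numbers \<open>b\<^sub>0 = 0, b\<^sub>1, b\<^sub>2, \<dots>\<close> are pairwise
  distinct.

  If \<open>f\<close> is closed and \<open>\<delta> Q f = 0\<close>, then \<open>T Q f = 0\<close>. This is a polynomial in \<open>T\<close> with the simple
  roots \<open>- b\<^sub>i\<close>, so \<open>f\<close> is a unique sum of eigenvectors \<open>f\<^sub>i\<close> (\<open>eigenvector_decomposition\<close>,
  \<open>eigenvectors_independent\<close>). The summand \<open>f\<^sub>0\<close> in the kernel of \<open>T\<close> is even harmonic: \<open>Q\<close> kills
  the other summands and multiplies \<open>f\<^sub>0\<close> by the nonzero number \<open>b\<^sub>1 b\<^sub>2 \<cdots> b\<^sub>m\<close>, where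
  \<open>m = (n - 2k)/2\<close>, so that \<open>\<delta> Q f = 0\<close> says \<open>\<delta> f\<^sub>0 = 0\<close>. This argument is purely algebraic and covers
  every signature. It gives the direct sum.

  In the pairing of \<open>u\<close> with \<open>Q w\<close> the second argument is therefore \<open>b\<^sub>1 \<cdots> b\<^sub>m w\<^sub>0\<close>. In the first
  one every \<open>u\<^sub>i\<close> with \<open>i \<ge> 1\<close> is the exact form \<open>d (- \<delta> u\<^sub>i / b\<^sub>i)\<close>, and exact forms are
  orthogonal to harmonic ones because \<open>\<delta>\<close> is adjoint to \<open>d\<close> (\<open>pairing_exact_harmonic\<close>). Only
  \<open>u\<^sub>0\<close> and \<open>w\<^sub>0\<close> survive, with the factor \<open>b\<^sub>1 \<cdots> b\<^sub>m = s\<^sup>k J\<^sup>m\<close> (\<open>pairing_Q\<close>).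

  Two facts about forms given by components carry this argument. The exterior derivative of a form
  is again a form, that is, its components transform correctly between charts
  (\<open>ext_deriv_in_forms\<close>), and its square vanishes (\<open>ext_deriv_ext_deriv\<close>). Both come from the
  symmetry of second partial derivatives (\<open>partial_deriv_commute\<close>) and one alternating double sum
  (\<open>symmetric_double_omit_cancel\<close>). Moreover the pairing is additive, because the contraction of
  two forms is a continuous function on a compact space of finite volume
  (\<open>integrable_contraction\<close>).
\<close>

section \<open>Index lists and alternating functions\<close>

definition omit :: "nat \<Rightarrow> 'b list \<Rightarrow> 'b list"
  where "omit j I = take j I @ drop (Suc j) I"

lemma length_omit [simp]: "j < length I \<Longrightarrow> length (omit j I) = length I - 1"
  by (simp add: omit_def)

lemma nth_omit: "j < length I \<Longrightarrow> r < length I - 1 \<Longrightarrow>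
    omit j I ! r = (if r < j then I ! r else I ! Suc r)"
  by (auto simp: omit_def nth_append min_def)

lemma omit_0_Cons [simp]: "omit 0 (a # L) = L"
  by (simp add: omit_def)

text \<open>The simplicial identity: removing two entries in either order, with the index shift that the
  first removal causes.\<close>

lemma omit_omit:
  assumes "j \<le> s" "Suc s < length I"
  shows "omit s (omit j I) = omit j (omit (Suc s) I)"
  using assms by (intro nth_equalityI) (auto simp: nth_omit)

abbreviation lists_of_length :: "nat \<Rightarrow> 'b list set"
  where "lists_of_length k \<equiv> {L. length L = k}"

lemma finite_lists_of_length [simp]: "finite (lists_of_length k :: 'b::finite list set)"
  using finite_lists_length_eq[of "UNIV :: 'b set" k] by simp

text \<open>A list of length \<open>k + 1\<close> amounts to its entry at position \<open>s\<close> together with the remaining list.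
  Using this at position \<open>s\<close> and at position \<open>0\<close> moves a summation index to the front.\<close>

lemma sum_lists_omit:
  fixes h :: "'b::finite \<Rightarrow> 'b list \<Rightarrow> 'c::comm_monoid_add"
  assumes "s \<le> k"
  shows "(\<Sum>L\<in>lists_of_length (Suc k). h (L ! s) (omit s L)) =
    (\<Sum>a\<in>UNIV. \<Sum>L\<in>lists_of_length k. h a L)"
proof -
  have "(\<Sum>L\<in>lists_of_length (Suc k). h (L ! s) (omit s L)) =
      (\<Sum>(a, L)\<in>UNIV \<times> lists_of_length k. h a L)"
  proof (rule sum.reindex_bij_witness[where i = "\<lambda>(a, L). take s L @ a # drop s L"
        and j = "\<lambda>L. (L ! s, omit s L)"])
    fix L :: "'b list" assume "L \<in> lists_of_length (Suc k)"
    then show "(case (L ! s, omit s L) of (a, L) \<Rightarrow> take s L @ a # drop s L) = L"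
      using assms by (simp add: omit_def id_take_nth_drop[of s L, symmetric])
  qed (use assms in \<open>auto simp: omit_def nth_append\<close>)
  then show ?thesis
    by (simp add: sum.cartesian_product)
qed

lemma sum_lists_prod_nth:
  fixes f :: "nat \<Rightarrow> 'b::finite \<Rightarrow> 'c::comm_semiring_1"
  shows "(\<Sum>L\<in>lists_of_length k. \<Prod>r<k. f r (L ! r)) = (\<Prod>r<k. \<Sum>a\<in>UNIV. f r a)"
proof (induction k arbitrary: f)
  case 0
  then show ?case by simp
next
  case (Suc k)
  have "(\<Sum>L\<in>lists_of_length (Suc k). \<Prod>r<Suc k. f r (L ! r)) =
      (\<Sum>L\<in>lists_of_length (Suc k). f 0 (L ! 0) * (\<Prod>r<k. f (Suc r) (omit 0 L ! r)))"
    by (intro sum.cong refl) (simp only: prod.lessThan_Suc_shift, simp add: nth_omit)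
  also have "\<dots> = (\<Sum>a\<in>UNIV. \<Sum>L\<in>lists_of_length k. f 0 a * (\<Prod>r<k. f (Suc r) (L ! r)))"
    by (rule sum_lists_omit) simp
  also have "\<dots> = (\<Prod>r<Suc k. \<Sum>a\<in>UNIV. f r a)"
    by (simp add: Suc[of "\<lambda>r. f (Suc r)"] prod.lessThan_Suc_shift sum_distrib_right flip: sum_distrib_left
        del: prod.lessThan_Suc)
  finally show ?case .
qed

lemma prod_omit:
  fixes h :: "'b \<Rightarrow> 'd \<Rightarrow> 'c::comm_monoid_mult"
  assumes "s \<le> k" "length K = Suc k" "length L = Suc k"
  shows "(\<Prod>r\<in>{..<Suc k} - {s}. h (K ! r) (L ! r)) = (\<Prod>r<k. h (omit s K ! r) (omit s L ! r))"
proof (rule prod.reindex_bij_witness[where i = "\<lambda>r. if r < s then r else Suc r"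
      and j = "\<lambda>r. if r < s then r else r - 1"])
qed (use assms in \<open>auto simp: nth_omit split: if_splits\<close>)

definition alternating :: "('b list \<Rightarrow> real) \<Rightarrow> bool"
  where "alternating F \<longleftrightarrow>
    (\<forall>I. \<forall>s<length I. \<forall>r<s. F (I[r := I ! s, s := I ! r]) = - F I)"

lemma alternating_swap:
  "alternating F \<Longrightarrow> r < s \<Longrightarrow> s < length I \<Longrightarrow> F (I[r := I ! s, s := I ! r]) = - F I"
  by (auto simp: alternating_def)

text \<open>Moving the entry at position \<open>s\<close> to the front takes \<open>s\<close> adjacent swaps, each of which costs a
  sign.\<close>

lemma alternating_move_front:
  assumes "alternating F" "s < length I"
  shows "F (I ! s # omit s I) = (-1) ^ s * F I"
  using assms(2)
proof (induction s arbitrary: I)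
  case 0
  then show ?case by (cases I) auto
next
  case (Suc s)
  define I' where "I' = I[s := I ! Suc s, Suc s := I ! s]"
  have "I' ! s # omit s I' = I ! Suc s # omit (Suc s) I"
    using Suc.prems by (intro nth_equalityI) (auto simp: I'_def nth_Cons' nth_omit nth_list_update)
  moreover have "F (I' ! s # omit s I') = (-1) ^ s * F I'"
    using Suc.prems by (intro Suc.IH) (simp add: I'_def)
  moreover have "F I' = - F I"
    unfolding I'_def using Suc.prems by (intro alternating_swap[OF assms(1)]) auto
  ultimately show ?case by simp
qed

text \<open>A transposition of distant positions is conjugate, by an adjacent swap, to one of positions that
  are closer by one; two of the three signs cancel.\<close>

lemma alternatingI_adjacent:
  fixes F :: "'b list \<Rightarrow> real"
  assumes adj: "\<And>I r. Suc r < length I \<Longrightarrow> F (I[r := I ! Suc r, Suc r := I ! r]) = - F I"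
  shows "alternating F"
  unfolding alternating_def
proof (intro allI impI)
  fix I :: "'b list" and s r :: nat
  assume "s < length I" "r < s"
  then show "F (I[r := I ! s, s := I ! r]) = - F I"
  proof (induction s arbitrary: I)
    case 0
    then show ?case by simp
  next
    case (Suc s)
    show ?case
    proof (cases "r = s")
      case True
      then show ?thesis using adj Suc.prems by simp
    next
      case False
      define I1 where "I1 = I[s := I ! Suc s, Suc s := I ! s]"
      define I2 where "I2 = I1[r := I1 ! s, s := I1 ! r]"
      have "I[r := I ! Suc s, Suc s := I ! r] = I2[s := I2 ! Suc s, Suc s := I2 ! s]"
        using Suc.prems False
        by (intro nth_equalityI) (auto simp: I1_def I2_def nth_list_update)
      then have "F (I[r := I ! Suc s, Suc s := I ! r]) = - F I2"
        using adj[of s I2] Suc.prems by (simp add: I1_def I2_def)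
      also have "F I2 = - F I1"
        unfolding I2_def using Suc.prems False by (intro Suc.IH) (auto simp: I1_def)
      also have "F I1 = - F I"
        using adj[of s I] Suc.prems by (simp add: I1_def)
      finally show ?thesis by simp
    qed
  qed
qed

text \<open>An adjacent swap of positions \<open>r\<close> and \<open>r + 1\<close> exchanges the terms \<open>j = r\<close> and \<open>j = r + 1\<close>, whose
  signs differ, and in every other term it acts as an adjacent swap on the shortened list.\<close>

lemma alternating_antisymmetrization:
  fixes D :: "'b \<Rightarrow> 'b list \<Rightarrow> real"
  assumes "\<And>a. alternating (D a)"
  shows "alternating (\<lambda>I. \<Sum>j<length I. (-1) ^ j * D (I ! j) (omit j I))"
proof (rule alternatingI_adjacent)
  fix I :: "'b list" and r :: nat
  assume r: "Suc r < length I"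
  define N where "N = length I"
  define I' where "I' = I[r := I ! Suc r, Suc r := I ! r]"
  define t where "t = (\<lambda>I j. (-1) ^ j * D (I ! j) (omit j I))"
  have split: "(\<Sum>j<N. h j) = h r + h (Suc r) + (\<Sum>j\<in>{..<N} - {r, Suc r}. h j)"
    for h :: "nat \<Rightarrow> real"
    using r by (subst sum.subset_diff[of "{r, Suc r}"]) (auto simp: N_def)
  have 1: "t I' r = - t I (Suc r)" "t I' (Suc r) = - t I r"
  proof -
    have "omit r I' = omit (Suc r) I" "omit (Suc r) I' = omit r I"
      using r by (auto intro!: nth_equalityI dest: less_antisym simp: I'_def nth_omit nth_list_update)
    then show "t I' r = - t I (Suc r)" "t I' (Suc r) = - t I r"
      using r by (auto simp: t_def I'_def)
  qed
  have 2: "t I' j = - t I j" if j: "j \<in> {..<N} - {r, Suc r}" for j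
  proof -
    define q where "q = (if j < r then r - 1 else r)"
    have "omit j I' = (omit j I)[q := omit j I ! Suc q, Suc q := omit j I ! q]"
      using r j by (intro nth_equalityI)
        (auto simp: I'_def q_def N_def nth_omit nth_list_update)
    moreover have "I' ! j = I ! j" "Suc q < length (omit j I)"
      using r j by (auto simp: I'_def N_def q_def)
    ultimately show ?thesis
      using alternating_swap[OF assms, of q "Suc q" "omit j I" "I ! j"] by (simp add: t_def)
  qed
  have "(\<Sum>j<length I'. t I' j) = (\<Sum>j<N. t I' j)" by (simp add: I'_def N_def)
  also have "\<dots> = - (\<Sum>j<N. t I j)"
    using 1 2 by (simp add: split sum_negf)
  finally show "(\<Sum>j<length (I[r := I ! Suc r, Suc r := I ! r]).
        (-1) ^ j * D (I[r := I ! Suc r, Suc r := I ! r] ! j) (omit j (I[r := I ! Suc r, Suc r := I ! r])))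
      = - (\<Sum>j<length I. (-1) ^ j * D (I ! j) (omit j I))"
    by (simp add: t_def I'_def N_def)
qed

text \<open>Each pair of positions is removed in both orders. The two terms have the same value of \<open>G\<close>, by
  symmetry and \<open>omit_omit\<close>, and opposite signs, since the later of the two positions is shifted by one
  in one of the orders. This cancellation yields both that the exterior derivative squares to zero
  and that it does not see second derivatives of a coordinate change.\<close>

lemma symmetric_double_omit_cancel:
  fixes G :: "'b \<Rightarrow> 'b \<Rightarrow> 'b list \<Rightarrow> real"
  assumes sym: "\<And>a b K. G a b K = G b a K"
  shows "(\<Sum>j<length I. (-1) ^ j *
    (\<Sum>s<length I - 1. (-1) ^ s * G (I ! j) (omit j I ! s) (omit s (omit j I)))) = 0"
proof -
  define N where "N = length I"
  define t where
    "t = (\<lambda>(j, s). (-1) ^ (j + s) * G (I ! j) (omit j I ! s) (omit s (omit j I)))"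
  \<comment> \<open>The involution matches \<open>X\<close> and \<open>Y\<close>, the pairs whose second removed position lies to the
    right, respectively to the left, of the first.\<close>
  define X where "X = {(j, s). j < N \<and> s < N - 1 \<and> j \<le> s}"
  define Y where "Y = {(j, s). j < N \<and> s < N - 1 \<and> s < j}"
  have XY: "{..<N} \<times> {..<N - 1} = X \<union> Y" "X \<inter> Y = {}"
    by (auto simp: X_def Y_def)
  have fin: "finite X" "finite Y"
    using finite_subset[of _ "{..<N} \<times> {..<N - 1}"] XY(1) by auto
  have "(\<Sum>x\<in>X. t x) = (\<Sum>y\<in>Y. - t y)"
  proof (rule sum.reindex_bij_witness[where i = "\<lambda>(j, s). (s, j - 1)"
        and j = "\<lambda>(j, s). (Suc s, j)"])
    fix x assume "x \<in> X"
    then obtain j s where x: "x = (j, s)" "j < N" "s < N - 1" "j \<le> s"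
      by (auto simp: X_def)
    have "omit s (omit j I) = omit j (omit (Suc s) I)"
      using x by (intro omit_omit) (auto simp: N_def)
    moreover have "omit j I ! s = I ! Suc s" "omit (Suc s) I ! j = I ! j"
      using x by (auto simp: nth_omit N_def)
    ultimately show "- t (case x of (j, s) \<Rightarrow> (Suc s, j)) = t x"
      using sym by (simp add: t_def x(1) power_add)
  qed (auto simp: X_def Y_def)
  then have "(\<Sum>x\<in>X \<union> Y. t x) = 0"
    using XY(2) fin by (simp add: sum.union_disjoint sum_negf)
  then show ?thesis
    by (simp add: XY(1)[symmetric] t_def N_def sum.cartesian_product[symmetric]
        sum_distrib_left power_add mult.assoc)
qed


section \<open>Partial derivatives and smooth functions\<close>

lemma partial_deriv_eqI: "(f has_derivative f') (at x) \<Longrightarrow> partial_deriv i f x = f' (axis i 1)"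
  unfolding partial_deriv_def by (metis frechet_derivative_at)

text \<open>The value of \<open>frechet_derivative\<close> is a choice among all derivatives at the point, and functions that
  agree near the point have the same ones.\<close>

lemma partial_deriv_cong_open:
  assumes "open S" "x \<in> S" "\<And>y. y \<in> S \<Longrightarrow> f y = g y"
  shows "partial_deriv i f x = partial_deriv i g x"
proof -
  have "(f has_derivative f') (at x) \<longleftrightarrow> (g has_derivative f') (at x)" for f'
    using assms has_derivative_transform_within_open[of f f' x UNIV S g]
      has_derivative_transform_within_open[of g f' x UNIV S f] by auto
  then show ?thesis
    by (simp add: partial_deriv_def frechet_derivative_def)
qed

lemma partial_deriv_const [simp]: "partial_deriv i (\<lambda>x. c) x = 0"
  by (rule partial_deriv_eqI) simp

lemma partial_deriv_add:
  "f differentiable at x \<Longrightarrow> g differentiable at x \<Longrightarrow>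
    partial_deriv i (\<lambda>y. f y + g y) x = partial_deriv i f x + partial_deriv i g x"
  by (rule partial_deriv_eqI[where f' = "\<lambda>h. frechet_derivative f (at x) h + frechet_derivative g (at x) h",
        folded partial_deriv_def])
    (intro has_derivative_add, auto simp: frechet_derivative_works)

lemma partial_deriv_cmult:
  "f differentiable at x \<Longrightarrow> partial_deriv i (\<lambda>y. a * f y) x = a * partial_deriv i f x"
  by (rule partial_deriv_eqI[where f' = "\<lambda>h. a * frechet_derivative f (at x) h",
        folded partial_deriv_def])
    (intro has_derivative_mult_right, auto simp: frechet_derivative_works)

lemma partial_deriv_sum:
  assumes "\<And>j. j \<in> I \<Longrightarrow> f j differentiable at x"
  shows "partial_deriv i (\<lambda>y. \<Sum>j\<in>I. f j y) x = (\<Sum>j\<in>I. partial_deriv i (f j) x)"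
  by (rule partial_deriv_eqI[where f' = "\<lambda>h. \<Sum>j\<in>I. frechet_derivative (f j) (at x) h",
        folded partial_deriv_def])
    (intro has_derivative_sum, use assms in \<open>auto simp: frechet_derivative_works\<close>)

lemma partial_deriv_mult:
  assumes "f differentiable at x" "g differentiable at x"
  shows "partial_deriv i (\<lambda>y. f y * g y) x = partial_deriv i f x * g x + f x * partial_deriv i g x"
proof -
  have "((\<lambda>y. f y * g y) has_derivative
      (\<lambda>h. f x * frechet_derivative g (at x) h + frechet_derivative f (at x) h * g x)) (at x)"
    using assms by (intro has_derivative_mult) (auto simp: frechet_derivative_works)
  from partial_deriv_eqI[OF this] show ?thesis
    by (simp add: partial_deriv_def)
qed

lemma partial_deriv_prod:
  assumes "\<And>j. j \<in> I \<Longrightarrow> f j differentiable at x"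
  shows "(\<lambda>y. \<Prod>j\<in>I. f j y) differentiable at x"
    and "partial_deriv i (\<lambda>y. \<Prod>j\<in>I. f j y) x =
      (\<Sum>s\<in>I. partial_deriv i (f s) x * (\<Prod>r\<in>I - {s}. f r x))"
proof -
  have D: "((\<lambda>y. \<Prod>j\<in>I. f j y) has_derivative
      (\<lambda>h. \<Sum>s\<in>I. frechet_derivative (f s) (at x) h * (\<Prod>r\<in>I - {s}. f r x))) (at x)"
    by (intro has_derivative_prod) (use assms in \<open>auto simp: frechet_derivative_works\<close>)
  then show "(\<lambda>y. \<Prod>j\<in>I. f j y) differentiable at x"
    by (rule differentiableI)
  show "partial_deriv i (\<lambda>y. \<Prod>j\<in>I. f j y) x =
      (\<Sum>s\<in>I. partial_deriv i (f s) x * (\<Prod>r\<in>I - {s}. f r x))"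
    using partial_deriv_eqI[OF D] by (simp add: partial_deriv_def)
qed

lemma Ck_on_cong:
  assumes "open S" "\<And>x. x \<in> S \<Longrightarrow> f x = g x"
  shows "Ck_on r S f \<longleftrightarrow> Ck_on r S g"
  using assms(2)
proof (induction r arbitrary: f g)
  case 0
  then show ?case using continuous_on_cong[of S S f g] by simp
next
  case (Suc r)
  have "f differentiable_on S \<longleftrightarrow> g differentiable_on S"
    using Suc.prems differentiable_transform_within[of _ _ S 1]
    unfolding differentiable_on_def by (metis zero_less_one)
  moreover have "Ck_on r S (partial_deriv i f) \<longleftrightarrow> Ck_on r S (partial_deriv i g)" for i
    by (rule Suc.IH) (use Suc.prems assms(1) partial_deriv_cong_open in blast)
  ultimately show ?case by simp
qed

lemma Ck_on_const:
  fixes S :: "(real ^ 'n::finite) set"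
  shows "Ck_on r S (\<lambda>x. c)"
proof (induction r arbitrary: c)
  case (Suc r)
  have "partial_deriv i (\<lambda>x. c) = (\<lambda>x. 0)" for i :: 'n by auto
  then show ?case using Suc by simp
qed simp

lemma Ck_on_add:
  assumes "open S" "Ck_on r S f" "Ck_on r S g"
  shows "Ck_on r S (\<lambda>x. f x + g x)"
  using assms(2-)
proof (induction r arbitrary: f g)
  case 0
  then show ?case by (simp add: continuous_on_add)
next
  case (Suc r)
  have *: "f differentiable at x" "g differentiable at x" if "x \<in> S" for x
    using Suc.prems that assms(1) by (auto simp: differentiable_on_eq_differentiable_at)
  have "Ck_on r S (partial_deriv i (\<lambda>x. f x + g x)) \<longleftrightarrow>
      Ck_on r S (\<lambda>x. partial_deriv i f x + partial_deriv i g x)" for i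
    by (rule Ck_on_cong[OF assms(1)]) (use * in \<open>auto simp: partial_deriv_add\<close>)
  then show ?case
    using Suc by (auto intro: differentiable_on_add)
qed

lemma Ck_on_cmult:
  assumes "open S" "Ck_on r S f"
  shows "Ck_on r S (\<lambda>x. a * f x)"
  using assms(2-)
proof (induction r arbitrary: f)
  case 0
  then show ?case by (simp add: continuous_on_mult)
next
  case (Suc r)
  have *: "f differentiable at x" if "x \<in> S" for x
    using Suc.prems that assms(1) by (auto simp: differentiable_on_eq_differentiable_at)
  have "Ck_on r S (partial_deriv i (\<lambda>x. a * f x)) \<longleftrightarrow>
      Ck_on r S (\<lambda>x. a * partial_deriv i f x)" for i
    by (rule Ck_on_cong[OF assms(1)]) (use * in \<open>auto simp: partial_deriv_cmult\<close>)
  then show ?case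
    using Suc by (auto intro: differentiable_on_mult)
qed

lemma smooth_on_cong:
  "open S \<Longrightarrow> (\<And>x. x \<in> S \<Longrightarrow> f x = g x) \<Longrightarrow> smooth_on S f \<longleftrightarrow> smooth_on S g"
  unfolding smooth_on_def using Ck_on_cong by blast

lemma smooth_on_const: "smooth_on S (\<lambda>x. c)"
  by (simp add: smooth_on_def Ck_on_const)

lemma smooth_on_add: "open S \<Longrightarrow> smooth_on S f \<Longrightarrow> smooth_on S g \<Longrightarrow> smooth_on S (\<lambda>x. f x + g x)"
  by (simp add: smooth_on_def Ck_on_add)

lemma smooth_on_cmult: "open S \<Longrightarrow> smooth_on S f \<Longrightarrow> smooth_on S (\<lambda>x. a * f x)"
  by (simp add: smooth_on_def Ck_on_cmult)

lemma smooth_on_sum: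
  assumes "open S" "\<And>j. j \<in> I \<Longrightarrow> smooth_on S (f j)"
  shows "smooth_on S (\<lambda>x. \<Sum>j\<in>I. f j x)"
  using assms(2)
  by (induction I rule: infinite_finite_induct)
    (auto simp: smooth_on_const intro!: smooth_on_add[OF assms(1)])

lemma smooth_on_partial_deriv: "smooth_on S f \<Longrightarrow> smooth_on S (partial_deriv i f)"
  unfolding smooth_on_def using Ck_on.simps(2) by blast

lemma smooth_on_continuous_on: "smooth_on S f \<Longrightarrow> continuous_on S f"
  unfolding smooth_on_def using Ck_on.simps(1) by blast

lemma smooth_on_differentiable_at:
  "smooth_on S f \<Longrightarrow> open S \<Longrightarrow> x \<in> S \<Longrightarrow> f differentiable at x"
  unfolding smooth_on_def using Ck_on.simps(2)[of 0]
  by (metis differentiable_on_eq_differentiable_at)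

lemma has_real_derivative_along_axis:
  assumes "f differentiable at (y + t *\<^sub>R axis i 1)"
  shows "((\<lambda>t. f (y + t *\<^sub>R axis i 1)) has_real_derivative
    partial_deriv i f (y + t *\<^sub>R axis i 1)) (at t)"
proof -
  let ?D = "frechet_derivative f (at (y + t *\<^sub>R axis i 1))"
  have D: "(f has_derivative ?D) (at (y + t *\<^sub>R axis i 1))"
    using assms frechet_derivative_works by blast
  have "((\<lambda>t. y + t *\<^sub>R axis i 1) has_derivative (\<lambda>h. h *\<^sub>R axis i 1)) (at t)"
    by (auto intro!: derivative_eq_intros)
  from has_derivative_compose[OF this D]
  have "((\<lambda>t. f (y + t *\<^sub>R axis i 1)) has_derivative (\<lambda>h. ?D (h *\<^sub>R axis i 1))) (at t)" .
  moreover have "(\<lambda>h. ?D (h *\<^sub>R axis i 1)) = (\<lambda>h. ?D (axis i 1) * h)"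
    using linear_scale[OF has_derivative_linear[OF D]] by (simp add: mult.commute)
  ultimately show ?thesis
    by (simp add: partial_deriv_def has_field_derivative_def)
qed

text \<open>The mean value theorem, applied first in direction \<open>i\<close> and then in direction \<open>j\<close>, turns the second
  difference over a square of side \<open>h\<close> into a mixed second derivative at a point of the square.\<close>

lemma second_difference_mean_value:
  fixes f :: "real ^ 'n::finite \<Rightarrow> real"
  assumes h: "0 < h"
    and S: "\<And>s t. 0 \<le> s \<Longrightarrow> s \<le> h \<Longrightarrow> 0 \<le> t \<Longrightarrow> t \<le> h \<Longrightarrow>
        f differentiable at (x + s *\<^sub>R axis i 1 + t *\<^sub>R axis j 1) \<and>
        partial_deriv i f differentiable at (x + s *\<^sub>R axis i 1 + t *\<^sub>R axis j 1)"
  obtains s t where "0 < s" "s < h" "0 < t" "t < h"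
    "f (x + h *\<^sub>R axis i 1 + h *\<^sub>R axis j 1) - f (x + h *\<^sub>R axis i 1)
       - f (x + h *\<^sub>R axis j 1) + f x =
     h * h * partial_deriv j (partial_deriv i f) (x + s *\<^sub>R axis i 1 + t *\<^sub>R axis j 1)"
proof -
  let ?i = "axis i 1 :: real ^ 'n" and ?j = "axis j 1 :: real ^ 'n"
  define \<phi> where "\<phi> = (\<lambda>s. f (x + s *\<^sub>R ?i + h *\<^sub>R ?j) - f (x + s *\<^sub>R ?i))"
  have "\<exists>s. 0 < s \<and> s < h \<and> \<phi> h - \<phi> 0 = (h - 0) *
      (partial_deriv i f (x + s *\<^sub>R ?i + h *\<^sub>R ?j) - partial_deriv i f (x + s *\<^sub>R ?i))"
  proof (rule MVT2[OF h])
    fix s assume s: "0 \<le> s" "s \<le> h"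
    have "((\<lambda>s. f (x + h *\<^sub>R ?j + s *\<^sub>R ?i)) has_real_derivative
        partial_deriv i f (x + h *\<^sub>R ?j + s *\<^sub>R ?i)) (at s)"
      using S[of s h] s h by (intro has_real_derivative_along_axis) (simp add: ac_simps)
    moreover have "((\<lambda>s. f (x + s *\<^sub>R ?i)) has_real_derivative
        partial_deriv i f (x + s *\<^sub>R ?i)) (at s)"
      using S[of s 0] s h by (intro has_real_derivative_along_axis) simp
    ultimately show "(\<phi> has_real_derivative
        partial_deriv i f (x + s *\<^sub>R ?i + h *\<^sub>R ?j) - partial_deriv i f (x + s *\<^sub>R ?i)) (at s)"
      unfolding \<phi>_def by (intro DERIV_diff) (simp_all add: ac_simps)
  qed
  then obtain s where s: "0 < s" "s < h" "\<phi> h - \<phi> 0 = h *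
      (partial_deriv i f (x + s *\<^sub>R ?i + h *\<^sub>R ?j) - partial_deriv i f (x + s *\<^sub>R ?i))"
    by auto
  define \<psi> where "\<psi> = (\<lambda>t. partial_deriv i f (x + s *\<^sub>R ?i + t *\<^sub>R ?j))"
  have "\<exists>t. 0 < t \<and> t < h \<and> \<psi> h - \<psi> 0 = (h - 0) *
      partial_deriv j (partial_deriv i f) (x + s *\<^sub>R ?i + t *\<^sub>R ?j)"
    unfolding \<psi>_def using S s
    by (intro MVT2[OF h] has_real_derivative_along_axis) simp
  then obtain t where t: "0 < t" "t < h" "\<psi> h - \<psi> 0 =
      h * partial_deriv j (partial_deriv i f) (x + s *\<^sub>R ?i + t *\<^sub>R ?j)"
    by auto
  show ?thesis
    using that[of s t] s t by (simp add: \<phi>_def \<psi>_def algebra_simps)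
qed

text \<open>The second difference is symmetric in the two directions, so the two mixed derivatives take the
  same value at two points of every small square; continuity at \<open>x\<close> then forces equality there.\<close>

lemma partial_deriv_commute:
  fixes f :: "real ^ 'n::finite \<Rightarrow> real"
  assumes "open S" "x \<in> S" "smooth_on S f"
  shows "partial_deriv i (partial_deriv j f) x = partial_deriv j (partial_deriv i f) x"
proof (rule ccontr)
  let ?p = "partial_deriv j (partial_deriv i f)" and ?q = "partial_deriv i (partial_deriv j f)"
  assume ne: "?q x \<noteq> ?p x"
  define e where "e = \<bar>?q x - ?p x\<bar> / 2"
  have e: "e > 0" using ne by (simp add: e_def)
  have cont: "continuous_on S ?p" "continuous_on S ?q"
    by (intro smooth_on_continuous_on smooth_on_partial_deriv assms)+
  then have "isCont ?p x" "isCont ?q x"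
    using assms by (auto simp: continuous_on_eq_continuous_at)
  then have "\<exists>d>0. \<forall>y. dist y x < d \<longrightarrow> dist (?p y) (?p x) < e"
    and "\<exists>d>0. \<forall>y. dist y x < d \<longrightarrow> dist (?q y) (?q x) < e"
    using e unfolding continuous_at_eps_delta by blast+
  then obtain d1 d2 where d1: "d1 > 0" "\<And>y. dist y x < d1 \<Longrightarrow> dist (?p y) (?p x) < e"
    and d2: "d2 > 0" "\<And>y. dist y x < d2 \<Longrightarrow> dist (?q y) (?q x) < e"
    by blast
  obtain d3 where d3: "d3 > 0" "ball x d3 \<subseteq> S"
    using assms openE by blast
  define h where "h = min d1 (min d2 d3) / 3"
  have h: "h > 0" "2 * h < d1" "2 * h < d2" "2 * h < d3"
    using d1(1) d2(1) d3(1) by (auto simp: h_def)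
  have near: "dist (x + s *\<^sub>R axis k 1 + t *\<^sub>R axis l 1) x \<le> 2 * h"
    if "0 \<le> s" "s \<le> h" "0 \<le> t" "t \<le> h" for s t and k l :: 'n
  proof -
    have "dist (x + s *\<^sub>R axis k 1 + t *\<^sub>R axis l 1) x = norm (s *\<^sub>R axis k 1 + t *\<^sub>R axis l 1 :: real ^ 'n)"
      by (simp add: dist_norm algebra_simps)
    also have "\<dots> \<le> norm (s *\<^sub>R axis k 1 :: real ^ 'n) + norm (t *\<^sub>R axis l 1 :: real ^ 'n)"
      by (rule norm_triangle_ineq)
    finally show ?thesis using that by simp
  qed
  have diff: "f differentiable at (x + s *\<^sub>R axis k 1 + t *\<^sub>R axis l 1) \<and>
      partial_deriv k f differentiable at (x + s *\<^sub>R axis k 1 + t *\<^sub>R axis l 1)"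
    if "0 \<le> s" "s \<le> h" "0 \<le> t" "t \<le> h" for s t and k l :: 'n
  proof -
    have "x + s *\<^sub>R axis k 1 + t *\<^sub>R axis l 1 \<in> S"
      using near[OF that, of k l] h d3 by (auto simp: dist_commute)
    then show ?thesis
      using assms smooth_on_differentiable_at smooth_on_partial_deriv by blast
  qed
  obtain s t where st: "0 < s" "s < h" "0 < t" "t < h"
    "f (x + h *\<^sub>R axis i 1 + h *\<^sub>R axis j 1) - f (x + h *\<^sub>R axis i 1)
       - f (x + h *\<^sub>R axis j 1) + f x =
     h * h * ?p (x + s *\<^sub>R axis i 1 + t *\<^sub>R axis j 1)"
    using second_difference_mean_value[OF h(1) diff] .
  obtain s' t' where st': "0 < s'" "s' < h" "0 < t'" "t' < h"
    "f (x + h *\<^sub>R axis j 1 + h *\<^sub>R axis i 1) - f (x + h *\<^sub>R axis j 1)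
       - f (x + h *\<^sub>R axis i 1) + f x =
     h * h * ?q (x + s' *\<^sub>R axis j 1 + t' *\<^sub>R axis i 1)"
    using second_difference_mean_value[OF h(1) diff] .
  have swap: "x + h *\<^sub>R axis j 1 + h *\<^sub>R axis i 1 = x + h *\<^sub>R axis i 1 + h *\<^sub>R axis j 1"
    by simp
  have "h * h * ?p (x + s *\<^sub>R axis i 1 + t *\<^sub>R axis j 1) =
      h * h * ?q (x + s' *\<^sub>R axis j 1 + t' *\<^sub>R axis i 1)"
    using st(5) st'(5) unfolding swap by linarith
  then have "?p (x + s *\<^sub>R axis i 1 + t *\<^sub>R axis j 1) =
      ?q (x + s' *\<^sub>R axis j 1 + t' *\<^sub>R axis i 1)"
    using h(1) by simp
  moreover have "dist (?p (x + s *\<^sub>R axis i 1 + t *\<^sub>R axis j 1)) (?p x) < e"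
    using near[of s t i j] st h by (intro d1(2)) auto
  moreover have "dist (?q (x + s' *\<^sub>R axis j 1 + t' *\<^sub>R axis i 1)) (?q x) < e"
    using near[of s' t' j i] st' h by (intro d2(2)) auto
  moreover have False if "a = b" "\<bar>a - p\<bar> < \<bar>q - p\<bar> / 2" "\<bar>b - q\<bar> < \<bar>q - p\<bar> / 2"
    for a b p q :: real
    using that abs_triangle_ineq4[of "a - p" "a - q"] by auto
  ultimately show False
    unfolding e_def dist_real_def by blast
qed

lemma partial_deriv_compose:
  fixes f :: "real ^ 'm::finite \<Rightarrow> real" and \<tau> :: "real ^ 'n::finite \<Rightarrow> real ^ 'm"
  assumes \<tau>: "\<And>a. (\<lambda>x. \<tau> x $ a) differentiable at x"
    and f: "f differentiable at (\<tau> x)"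
  shows "(\<lambda>x. f (\<tau> x)) differentiable at x"
    and "partial_deriv i (\<lambda>x. f (\<tau> x)) x =
      (\<Sum>a\<in>UNIV. partial_deriv i (\<lambda>x. \<tau> x $ a) x * partial_deriv a f (\<tau> x))"
proof -
  let ?D = "frechet_derivative f (at (\<tau> x))"
  define \<tau>' where "\<tau>' = (\<lambda>h. \<chi> a. frechet_derivative (\<lambda>x. \<tau> x $ a) (at x) h)"
  have "(\<tau> has_derivative \<tau>') (at x)"
    unfolding \<tau>'_def has_derivative_componentwise_within[of \<tau>]
    using \<tau> by (auto simp: Basis_vec_def inner_axis frechet_derivative_works[symmetric])
  moreover have D: "(f has_derivative ?D) (at (\<tau> x))"
    using f frechet_derivative_works by blast
  ultimately have fD: "((\<lambda>x. f (\<tau> x)) has_derivative (\<lambda>h. ?D (\<tau>' h))) (at x)"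
    by (rule has_derivative_compose)
  then show "(\<lambda>x. f (\<tau> x)) differentiable at x"
    by (rule differentiableI)
  have "partial_deriv i (\<lambda>x. f (\<tau> x)) x = ?D (\<tau>' (axis i 1))"
    using partial_deriv_eqI[OF fD] .
  also have "\<tau>' (axis i 1) = (\<Sum>a\<in>UNIV. partial_deriv i (\<lambda>x. \<tau> x $ a) x *\<^sub>R axis a 1)"
    by (simp add: \<tau>'_def vec_eq_iff partial_deriv_def axis_def if_distrib cong: if_cong)
  also have "?D \<dots> = (\<Sum>a\<in>UNIV. partial_deriv i (\<lambda>x. \<tau> x $ a) x * partial_deriv a f (\<tau> x))"
    using has_derivative_linear[OF D]
    by (simp add: linear_sum linear_scale partial_deriv_def)
  finally show "partial_deriv i (\<lambda>x. f (\<tau> x)) x =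
      (\<Sum>a\<in>UNIV. partial_deriv i (\<lambda>x. \<tau> x $ a) x * partial_deriv a f (\<tau> x))" .
qed


section \<open>The exterior derivative on forms\<close>

text \<open>Naturality of the exterior derivative in \<open>\<real>\<^sup>n\<close>. By the product and chain rules, differentiating
  \<open>\<omega>\<close>, the pullback of \<open>\<eta>\<close> along \<open>\<tau>\<close>, produces the pullback of the derivatives of \<open>\<eta>\<close> and terms
  with a second derivative of \<open>\<tau>\<close>. As \<open>\<eta>\<close> alternates, the index on which the second derivative acts can
  be moved to the front with a sign; the result is symmetric in the two differentiated directions and
  cancels in the antisymmetrisation.\<close>

lemma ext_deriv_pullback:
  fixes \<tau> :: "real ^ 'n::finite \<Rightarrow> real ^ 'm::finite" and \<eta> :: "'m list \<Rightarrow> real ^ 'm \<Rightarrow> real"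
    and \<omega> :: "'n list \<Rightarrow> real ^ 'n \<Rightarrow> real"
  assumes U: "open U" "x \<in> U"
    and \<tau>: "\<And>a. smooth_on U (\<lambda>x. \<tau> x $ a)"
    and \<eta>: "\<And>L. \<eta> L differentiable at (\<tau> x)"
    and alt: "alternating (\<lambda>L. \<eta> L (\<tau> x))"
    and \<omega>: "\<And>K y. length K = k \<Longrightarrow> y \<in> U \<Longrightarrow> \<omega> K y = (\<Sum>L\<in>lists_of_length k.
      (\<Prod>r<k. partial_deriv (K ! r) (\<lambda>x. \<tau> x $ (L ! r)) y) * \<eta> L (\<tau> y))"
    and I: "length I = Suc k"
  shows "(\<Sum>j<Suc k. (-1) ^ j * partial_deriv (I ! j) (\<omega> (omit j I)) x) =
    (\<Sum>L\<in>lists_of_length (Suc k).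
      (\<Prod>r<Suc k. partial_deriv (I ! r) (\<lambda>x. \<tau> x $ (L ! r)) x) *
      (\<Sum>j<Suc k. (-1) ^ j * partial_deriv (L ! j) (\<eta> (omit j L)) (\<tau> x)))"
proof -
  define P where "P = (\<lambda>i l. partial_deriv i (\<lambda>x. \<tau> x $ l) x)"
  define S where "S = (\<lambda>a b c. partial_deriv a (partial_deriv b (\<lambda>x. \<tau> x $ c)) x)"
  define e where "e = (\<lambda>L. \<eta> L (\<tau> x))"
  define D where "D = (\<lambda>b L. partial_deriv b (\<eta> L) (\<tau> x))"
  define H where "H = (\<lambda>a K. \<Sum>L\<in>lists_of_length k.
    (\<Sum>s<k. S a (K ! s) (L ! s) * (\<Prod>r\<in>{..<k} - {s}. P (K ! r) (L ! r))) * e L)"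
  define F where "F = (\<lambda>a K. \<Sum>L\<in>lists_of_length k.
    (\<Prod>r<k. P (K ! r) (L ! r)) * (\<Sum>b\<in>UNIV. P a b * D b L))"
  define G where "G = (\<lambda>a b K. \<Sum>c\<in>UNIV. \<Sum>M\<in>lists_of_length (k - 1).
    S a b c * (\<Prod>r<k - 1. P (K ! r) (M ! r)) * e (c # M))"
  have diff1: "(\<lambda>x. \<tau> x $ c) differentiable at x" for c
    using smooth_on_differentiable_at[OF \<tau> U] .
  have diff2: "partial_deriv b (\<lambda>x. \<tau> x $ c) differentiable at x" for b c
    using smooth_on_differentiable_at[OF smooth_on_partial_deriv[OF \<tau>] U] .
  have d\<omega>: "partial_deriv a (\<omega> K) x = H a K + F a K" if K: "length K = k" for a K
  proof -
    define q where "q = (\<lambda>L y. \<Prod>r<k. partial_deriv (K ! r) (\<lambda>x. \<tau> x $ (L ! r)) y)"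
    have q: "q L differentiable at x" "partial_deriv a (q L) x =
        (\<Sum>s<k. S a (K ! s) (L ! s) * (\<Prod>r\<in>{..<k} - {s}. P (K ! r) (L ! r)))" for L
      unfolding q_def S_def P_def using diff2 by (auto intro!: partial_deriv_prod)
    have \<eta>\<tau>: "(\<lambda>y. \<eta> L (\<tau> y)) differentiable at x"
      "partial_deriv a (\<lambda>y. \<eta> L (\<tau> y)) x = (\<Sum>b\<in>UNIV. P a b * D b L)" for L
      unfolding P_def D_def by (rule partial_deriv_compose[OF diff1 \<eta>])+
    have "partial_deriv a (\<omega> K) x =
        partial_deriv a (\<lambda>y. \<Sum>L\<in>lists_of_length k. q L y * \<eta> L (\<tau> y)) x"
      by (rule partial_deriv_cong_open[OF U]) (simp add: \<omega> K q_def)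
    also have "\<dots> = (\<Sum>L\<in>lists_of_length k. partial_deriv a (\<lambda>y. q L y * \<eta> L (\<tau> y)) x)"
      by (intro partial_deriv_sum differentiable_mult q \<eta>\<tau>)
    also have "\<dots> = (\<Sum>L\<in>lists_of_length k. partial_deriv a (q L) x * e L +
        q L x * (\<Sum>b\<in>UNIV. P a b * D b L))"
      by (simp add: partial_deriv_mult[OF q(1) \<eta>\<tau>(1)] \<eta>\<tau>(2) e_def)
    also have "\<dots> = H a K + F a K"
      by (simp add: q(2) H_def F_def sum.distrib) (simp add: q_def P_def)
    finally show ?thesis .
  qed
  \<comment> \<open>\<open>H\<close> collects the terms with second derivatives of \<open>\<tau>\<close>, and \<open>G\<close> is their common shape after
    the affected index has been moved to the front.\<close>
  have H: "H a K = (\<Sum>s<k. (-1) ^ s * G a (K ! s) (omit s K))" if K: "length K = k" for a K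
  proof -
    have "H a K = (\<Sum>s<k. \<Sum>L\<in>lists_of_length k.
        S a (K ! s) (L ! s) * (\<Prod>r\<in>{..<k} - {s}. P (K ! r) (L ! r)) * e L)"
      unfolding H_def by (subst sum.swap) (simp add: sum_distrib_right)
    also have "\<dots> = (\<Sum>s<k. (-1) ^ s * G a (K ! s) (omit s K))"
    proof (rule sum.cong[OF refl])
      fix s assume "s \<in> {..<k}"
      then obtain k' where k': "k = Suc k'" "s \<le> k'"
        by (cases k) auto
      have "(\<Sum>L\<in>lists_of_length k.
          S a (K ! s) (L ! s) * (\<Prod>r\<in>{..<k} - {s}. P (K ! r) (L ! r)) * e L) =
        (\<Sum>L\<in>lists_of_length (Suc k'). S a (K ! s) (L ! s) *
          (\<Prod>r<k'. P (omit s K ! r) (omit s L ! r)) * ((-1) ^ s * e (L ! s # omit s L)))"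
      proof (intro sum.cong)
        fix L :: "'m list" assume "L \<in> lists_of_length (Suc k')"
        then show "S a (K ! s) (L ! s) * (\<Prod>r\<in>{..<k} - {s}. P (K ! r) (L ! r)) * e L =
            S a (K ! s) (L ! s) * (\<Prod>r<k'. P (omit s K ! r) (omit s L ! r)) *
              ((-1) ^ s * e (L ! s # omit s L))"
          using alternating_move_front[OF alt, of s L] K k'
          by (simp add: prod_omit e_def flip: power_add mult.assoc mult_2)
      qed (simp add: k')
      also have "\<dots> = (\<Sum>c\<in>UNIV. \<Sum>M\<in>lists_of_length k'. S a (K ! s) c *
          (\<Prod>r<k'. P (omit s K ! r) (M ! r)) * ((-1) ^ s * e (c # M)))"
        by (rule sum_lists_omit[OF k'(2)])
      also have "\<dots> = (-1) ^ s * G a (K ! s) (omit s K)"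
        by (simp add: G_def k' sum_distrib_left mult_ac)
      finally show "(\<Sum>L\<in>lists_of_length k.
          S a (K ! s) (L ! s) * (\<Prod>r\<in>{..<k} - {s}. P (K ! r) (L ! r)) * e L) =
        (-1) ^ s * G a (K ! s) (omit s K)" .
    qed
    finally show ?thesis .
  qed
  have "S a b c = S b a c" for a b c
    unfolding S_def by (rule partial_deriv_commute[OF U \<tau>])
  then have "G a b K = G b a K" for a b K
    unfolding G_def by simp
  from symmetric_double_omit_cancel[of G I, OF this]
  have Hsum: "(\<Sum>j<Suc k. (-1) ^ j * H (I ! j) (omit j I)) = 0"
    using I H by simp
  have F: "F (I ! j) (omit j I) =
      (\<Sum>L\<in>lists_of_length (Suc k). (\<Prod>r<Suc k. P (I ! r) (L ! r)) * D (L ! j) (omit j L))"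
    if j: "j < Suc k" for j
  proof -
    have "(\<Sum>L\<in>lists_of_length (Suc k). (\<Prod>r<Suc k. P (I ! r) (L ! r)) * D (L ! j) (omit j L)) =
        (\<Sum>L\<in>lists_of_length (Suc k). P (I ! j) (L ! j) *
          (\<Prod>r<k. P (omit j I ! r) (omit j L ! r)) * D (L ! j) (omit j L))"
    proof (rule sum.cong[OF refl])
      fix L :: "'m list" assume "L \<in> lists_of_length (Suc k)"
      then have "(\<Prod>r<Suc k. P (I ! r) (L ! r)) =
          P (I ! j) (L ! j) * (\<Prod>r<k. P (omit j I ! r) (omit j L ! r))"
        using j I prod_omit[of j k I L P]
        by (subst prod.remove[of _ j]) auto
      then show "(\<Prod>r<Suc k. P (I ! r) (L ! r)) * D (L ! j) (omit j L) =
          P (I ! j) (L ! j) * (\<Prod>r<k. P (omit j I ! r) (omit j L ! r)) * D (L ! j) (omit j L)"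
        by simp
    qed
    also have "\<dots> = (\<Sum>b\<in>UNIV. \<Sum>L\<in>lists_of_length k. P (I ! j) b *
        (\<Prod>r<k. P (omit j I ! r) (L ! r)) * D b L)"
      by (rule sum_lists_omit) (use j in simp)
    also have "\<dots> = F (I ! j) (omit j I)"
      unfolding F_def by (subst sum.swap) (simp add: sum_distrib_left sum_distrib_right mult_ac)
    finally show ?thesis by simp
  qed
  have "(\<Sum>j<Suc k. (-1) ^ j * partial_deriv (I ! j) (\<omega> (omit j I)) x) =
      (\<Sum>j<Suc k. (-1) ^ j * F (I ! j) (omit j I))"
    using Hsum I by (simp add: d\<omega> ring_distribs sum.distrib del: sum.lessThan_Suc)
  also have "\<dots> = (\<Sum>j<Suc k. \<Sum>L\<in>lists_of_length (Suc k).
      (\<Prod>r<Suc k. P (I ! r) (L ! r)) * ((-1) ^ j * D (L ! j) (omit j L)))"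
    by (rule sum.cong[OF refl]) (simp add: F sum_distrib_left mult.left_commute
        del: prod.lessThan_Suc)
  also have "\<dots> = (\<Sum>L\<in>lists_of_length (Suc k). (\<Prod>r<Suc k. P (I ! r) (L ! r)) *
      (\<Sum>j<Suc k. (-1) ^ j * D (L ! j) (omit j L)))"
    by (subst sum.swap) (simp add: sum_distrib_left del: prod.lessThan_Suc sum.lessThan_Suc)
  finally show ?thesis
    unfolding P_def D_def .
qed

lemma atlas_chart:
  assumes "smooth_atlas A" "c \<in> A"
  shows "open (chart_dom c)" "open (coords c ` chart_dom c)"
    "homeomorphism (chart_dom c) (coords c ` chart_dom c) (coords c) (uncoords c)"
  using assms by (auto simp: smooth_atlas_def)

lemma atlas_uncoords:
  assumes "smooth_atlas A" "c \<in> A" "p \<in> chart_dom c"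
  shows "uncoords c (coords c p) = p"
  using homeomorphism_apply1[OF atlas_chart(3)[OF assms(1,2)] assms(3)] .

lemma atlas_open_image:
  assumes "smooth_atlas A" "c \<in> A" "open W" "W \<subseteq> chart_dom c"
  shows "open (coords c ` W)"
proof -
  have "openin (top_of_set (coords c ` chart_dom c)) (coords c ` W)"
    using homeomorphism_imp_open_map[OF atlas_chart(3)[OF assms(1,2)]] assms
    by (simp add: openin_open_eq atlas_chart)
  then show ?thesis
    using openin_open_eq[OF atlas_chart(2)[OF assms(1,2)]] by auto
qed

lemma ext_deriv_eq:
  "c \<in> A \<Longrightarrow> p \<in> chart_dom c \<Longrightarrow> ext_deriv A \<omega> c p I = (\<Sum>j<length I. (-1) ^ j *
    partial_deriv (I ! j) (\<lambda>x. \<omega> c (uncoords c x) (omit j I)) (coords c p))"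
  by (simp add: ext_deriv_def chart_pd_def omit_def)

lemma forms_outside:
  "\<omega> \<in> forms A k \<Longrightarrow> \<not> (c \<in> A \<and> p \<in> chart_dom c \<and> length I = k) \<Longrightarrow> \<omega> c p I = 0"
  unfolding forms_def by blast

lemma forms_smooth:
  "\<omega> \<in> forms A k \<Longrightarrow> c \<in> A \<Longrightarrow>
    smooth_on (coords c ` chart_dom c) (\<lambda>x. \<omega> c (uncoords c x) I)"
  unfolding forms_def by blast

lemma forms_alternating:
  "\<omega> \<in> forms A k \<Longrightarrow> c \<in> A \<Longrightarrow> p \<in> chart_dom c \<Longrightarrow> alternating (\<omega> c p)"
  unfolding forms_def alternating_def by blast

lemma forms_change:
  "\<omega> \<in> forms A k \<Longrightarrow> c \<in> A \<Longrightarrow> c' \<in> A \<Longrightarrow> p \<in> chart_dom c \<inter> chart_dom c' \<Longrightarrow> length I = k \<Longrightarrow>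
    \<omega> c p I = (\<Sum>L\<in>lists_of_length k. (\<Prod>r<k. jac c c' p $ (L ! r) $ (I ! r)) * \<omega> c' p L)"
  unfolding forms_def by blast

lemma forms_differentiable:
  assumes "smooth_atlas A" "\<omega> \<in> forms A k" "c \<in> A" "p \<in> chart_dom c"
  shows "(\<lambda>x. \<omega> c (uncoords c x) I) differentiable at (coords c p)"
  using assms by (intro smooth_on_differentiable_at[OF forms_smooth] atlas_chart) auto

text \<open>Smoothness and the alternating property are inherited from the components; the
  transformation law between two charts is \<open>ext_deriv_pullback\<close> for the coordinate change.\<close>

lemma ext_deriv_in_forms:
  fixes A :: "('a::{t2_space, second_countable_topology}, 'n::finite) chart set"
  assumes A: "smooth_atlas A" and \<omega>: "\<omega> \<in> forms A k"
  shows "ext_deriv A \<omega> \<in> forms A (Suc k)"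
  unfolding forms_def mem_Collect_eq
proof (intro conjI allI ballI impI)
  fix c p and I :: "'n list"
  assume *: "\<not> (c \<in> A \<and> p \<in> chart_dom c \<and> length I = Suc k)"
  show "ext_deriv A \<omega> c p I = 0"
  proof (cases "c \<in> A \<and> p \<in> chart_dom c")
    case True
    have "\<omega> c q (omit j I) = 0" if "j < length I" for q j
      by (rule forms_outside[OF \<omega>]) (use * True that in auto)
    then show ?thesis using True by (simp add: ext_deriv_eq)
  qed (auto simp: ext_deriv_def)
next
  fix c and I :: "'n list"
  assume c: "c \<in> A"
  let ?S = "coords c ` chart_dom c"
  have "smooth_on ?S (\<lambda>x. \<Sum>j<length I. (-1) ^ j *
      partial_deriv (I ! j) (\<lambda>x. \<omega> c (uncoords c x) (omit j I)) x)"
    by (intro smooth_on_sum smooth_on_cmult smooth_on_partial_deriv forms_smooth[OF \<omega> c]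
        atlas_chart(2)[OF A c])
  then show "smooth_on ?S (\<lambda>x. ext_deriv A \<omega> c (uncoords c x) I)"
    by (rule smooth_on_cong[THEN iffD1, rotated 2])
      (auto simp: atlas_chart[OF A c] atlas_uncoords[OF A c] ext_deriv_eq[OF c])
next
  fix c p and I :: "'n list" and s r
  assume c: "c \<in> A" and p: "p \<in> chart_dom c" and rs: "s < length I" "r < s"
  define D where "D = (\<lambda>a L. partial_deriv a (\<lambda>x. \<omega> c (uncoords c x) L) (coords c p))"
  have "alternating (D a)" for a
    unfolding alternating_def
  proof (intro allI impI)
    fix I :: "'n list" and s r :: nat
    assume rs: "s < length I" "r < s"
    have "D a (I[r := I ! s, s := I ! r]) =
        partial_deriv a (\<lambda>x. (-1) * \<omega> c (uncoords c x) I) (coords c p)"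
      unfolding D_def
    proof (rule partial_deriv_cong_open[OF atlas_chart(2)[OF A c]])
      fix y assume "y \<in> coords c ` chart_dom c"
      then have "uncoords c y \<in> chart_dom c"
        using atlas_uncoords[OF A c] by auto
      from alternating_swap[OF forms_alternating[OF \<omega> c this] rs(2,1)]
      show "\<omega> c (uncoords c y) (I[r := I ! s, s := I ! r]) = (-1) * \<omega> c (uncoords c y) I"
        by simp
    qed (use p in simp)
    also have "\<dots> = - D a I"
      by (simp only: partial_deriv_cmult[OF forms_differentiable[OF A \<omega> c p]] D_def)
    finally show "D a (I[r := I ! s, s := I ! r]) = - D a I" .
  qed
  then have "alternating (\<lambda>I. \<Sum>j<length I. (-1) ^ j * D (I ! j) (omit j I))"
    by (rule alternating_antisymmetrization)
  from alternating_swap[OF this rs(2,1)]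
  show "ext_deriv A \<omega> c p (I[r := I ! s, s := I ! r]) = - ext_deriv A \<omega> c p I"
    by (simp only: D_def ext_deriv_eq[OF c p])
next
  fix c c' p and I :: "'n list"
  assume c: "c \<in> A" and c': "c' \<in> A" and p: "p \<in> chart_dom c \<inter> chart_dom c'"
    and I: "length I = Suc k"
  define U where "U = coords c ` (chart_dom c \<inter> chart_dom c')"
  define \<tau> where "\<tau> = (\<lambda>x. coords c' (uncoords c x))"
  have jac: "jac c c' q $ l $ i = partial_deriv i (\<lambda>x. \<tau> x $ l) (coords c q)" for q i l
    by (simp add: jac_def chart_pd_def \<tau>_def)
  have U: "open U" "coords c p \<in> U"
    unfolding U_def using p
    by (auto intro!: atlas_open_image[OF A c] open_Int atlas_chart[OF A] c c')
  have \<tau>p: "\<tau> (coords c p) = coords c' p"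
    using p by (simp add: \<tau>_def atlas_uncoords[OF A c])
  have "ext_deriv A \<omega> c p I = (\<Sum>j<Suc k. (-1) ^ j * partial_deriv (I ! j)
      ((\<lambda>K x. \<omega> c (uncoords c x) K) (omit j I)) (coords c p))"
    using c p I by (simp add: ext_deriv_eq del: sum.lessThan_Suc)
  also have "\<dots> = (\<Sum>L\<in>lists_of_length (Suc k).
      (\<Prod>r<Suc k. partial_deriv (I ! r) (\<lambda>x. \<tau> x $ (L ! r)) (coords c p)) *
      (\<Sum>j<Suc k. (-1) ^ j * partial_deriv (L ! j)
        ((\<lambda>L y. \<omega> c' (uncoords c' y) L) (omit j L)) (\<tau> (coords c p))))"
  proof (rule ext_deriv_pullback[OF U _ _ _ _ I])
    show "smooth_on U (\<lambda>x. \<tau> x $ a)" for a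
      using A c c' unfolding smooth_atlas_def U_def \<tau>_def by blast
    show "(\<lambda>y. \<omega> c' (uncoords c' y) L) differentiable at (\<tau> (coords c p))" for L
      unfolding \<tau>p using p by (intro forms_differentiable[OF A \<omega> c']) simp
    show "alternating (\<lambda>L. \<omega> c' (uncoords c' (\<tau> (coords c p))) L)"
      unfolding \<tau>p using p forms_alternating[OF \<omega> c', of p] by (simp add: atlas_uncoords[OF A c'])
    fix K :: "'n list" and y assume K: "length K = k" and "y \<in> U"
    then obtain q where q: "y = coords c q" "q \<in> chart_dom c \<inter> chart_dom c'"
      by (auto simp: U_def)
    then have "uncoords c y = q" "uncoords c' (\<tau> y) = q"
      by (auto simp: \<tau>_def atlas_uncoords[OF A c] atlas_uncoords[OF A c'])
    then show "\<omega> c (uncoords c y) K = (\<Sum>L\<in>lists_of_length k.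
        (\<Prod>r<k. partial_deriv (K ! r) (\<lambda>x. \<tau> x $ (L ! r)) y) * \<omega> c' (uncoords c' (\<tau> y)) L)"
      using forms_change[OF \<omega> c c' q(2) K] by (simp add: jac q(1))
  qed
  also have "\<dots> = (\<Sum>L | length L = Suc k. (\<Prod>r<Suc k. jac c c' p $ (L ! r) $ (I ! r)) *
      ext_deriv A \<omega> c' p L)"
    unfolding jac \<tau>p using c' p
    by (intro sum.cong refl) (simp add: ext_deriv_eq del: sum.lessThan_Suc prod.lessThan_Suc)
  finally show "ext_deriv A \<omega> c p I = (\<Sum>L | length L = Suc k.
      (\<Prod>r<Suc k. jac c c' p $ (L ! r) $ (I ! r)) * ext_deriv A \<omega> c' p L)" .
qed

lemma ext_deriv_ext_deriv:
  assumes A: "smooth_atlas A" and \<omega>: "\<omega> \<in> forms A k"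
  shows "ext_deriv A (ext_deriv A \<omega>) = 0"
proof -
  have "ext_deriv A (ext_deriv A \<omega>) c p I = 0" if c: "c \<in> A" and p: "p \<in> chart_dom c" for c p I
  proof -
    let ?S = "coords c ` chart_dom c"
    define w where "w = (\<lambda>K x. \<omega> c (uncoords c x) K)"
    have w: "smooth_on ?S (w K)" for K
      unfolding w_def by (rule forms_smooth[OF \<omega> c])
    have S: "open ?S" "coords c p \<in> ?S"
      using atlas_chart[OF A c] p by auto
    have diff: "partial_deriv a (w K) differentiable at (coords c p)" for a K
      by (rule smooth_on_differentiable_at[OF smooth_on_partial_deriv[OF w] S])
    have "partial_deriv a (\<lambda>x. ext_deriv A \<omega> c (uncoords c x) K) (coords c p) =
        (\<Sum>s<length K. (-1) ^ s *
          partial_deriv a (partial_deriv (K ! s) (w (omit s K))) (coords c p))" for a K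
    proof -
      have "partial_deriv a (\<lambda>x. ext_deriv A \<omega> c (uncoords c x) K) (coords c p) =
          partial_deriv a (\<lambda>x. \<Sum>s<length K. (-1) ^ s * partial_deriv (K ! s) (w (omit s K)) x)
            (coords c p)"
        by (rule partial_deriv_cong_open[OF S])
          (auto simp: ext_deriv_eq[OF c] w_def atlas_uncoords[OF A c])
      also have "\<dots> = (\<Sum>s<length K.
          partial_deriv a (\<lambda>x. (-1) ^ s * partial_deriv (K ! s) (w (omit s K)) x) (coords c p))"
        by (intro partial_deriv_sum differentiable_mult differentiable_const diff)
      finally show ?thesis
        by (simp add: partial_deriv_cmult[OF diff])
    qed
    then have "ext_deriv A (ext_deriv A \<omega>) c p I = (\<Sum>j<length I. (-1) ^ j *
        (\<Sum>s<length I - 1. (-1) ^ s * partial_deriv (I ! j) (partial_deriv (omit j I ! s)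
          (w (omit s (omit j I)))) (coords c p)))"
      using c p by (simp add: ext_deriv_eq)
    also have "\<dots> = 0"
      using partial_deriv_commute[OF S w]
      by (intro symmetric_double_omit_cancel[where
            G = "\<lambda>a b K. partial_deriv a (partial_deriv b (w K)) (coords c p)"])
    finally show ?thesis .
  qed
  then show ?thesis
    by (auto simp: fun_eq_iff ext_deriv_def)
qed

lemma ext_deriv_linear:
  assumes A: "smooth_atlas A" and "\<phi> \<in> forms A k" "\<psi> \<in> forms A k"
  shows "ext_deriv A (\<phi> + \<psi>) = ext_deriv A \<phi> + ext_deriv A \<psi>"
    and "ext_deriv A (a *\<^sub>R \<phi>) = a *\<^sub>R ext_deriv A \<phi>"
proof -
  have "ext_deriv A (\<phi> + \<psi>) c p I = ext_deriv A \<phi> c p I + ext_deriv A \<psi> c p I \<and>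
      ext_deriv A (a *\<^sub>R \<phi>) c p I = a * ext_deriv A \<phi> c p I" for c p I
  proof (cases "c \<in> A \<and> p \<in> chart_dom c")
    case True
    then show ?thesis
      using assms
      by (simp add: ext_deriv_eq scaleR_fun_def partial_deriv_add partial_deriv_cmult
          forms_differentiable ring_distribs sum.distrib sum_distrib_left mult.left_commute)
  qed (auto simp: ext_deriv_def)
  then show "ext_deriv A (\<phi> + \<psi>) = ext_deriv A \<phi> + ext_deriv A \<psi>"
    and "ext_deriv A (a *\<^sub>R \<phi>) = a *\<^sub>R ext_deriv A \<phi>"
    by (auto simp: fun_eq_iff scaleR_fun_def)
qed

lemma subspace_forms:
  assumes A: "smooth_atlas A"
  shows "subspace (forms A k)"
  unfolding subspace_def
proof (intro conjI ballI allI)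
  show "0 \<in> forms A k"
    by (auto simp: forms_def smooth_on_const)
next
  fix \<phi> \<psi> assume *: "\<phi> \<in> forms A k" "\<psi> \<in> forms A k"
  show "\<phi> + \<psi> \<in> forms A k"
    unfolding forms_def mem_Collect_eq
  proof (intro conjI allI ballI impI, goal_cases)
    case (1 c p I)
    then show ?case using *[THEN forms_outside] by simp
  next
    case (2 c I)
    then show ?case
      using *[THEN forms_smooth] atlas_chart(2)[OF A] by (simp add: smooth_on_add)
  next
    case (3 c p I s r)
    then show ?case using *[THEN forms_alternating] by (simp add: alternating_swap)
  next
    case (4 c c' p I)
    then show ?case
      using *[THEN forms_change, of c c' p I] by (simp add: ring_distribs sum.distrib)
  qed
next
  fix a \<phi> assume *: "\<phi> \<in> forms A k"
  show "a *\<^sub>R \<phi> \<in> forms A k"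
    unfolding forms_def mem_Collect_eq scaleR_fun_def real_scaleR_def
  proof (intro conjI allI ballI impI, goal_cases)
    case (1 c p I)
    then show ?case using forms_outside[OF *] by simp
  next
    case (2 c I)
    then show ?case
      using forms_smooth[OF *] atlas_chart(2)[OF A] by (simp add: smooth_on_cmult)
  next
    case (3 c p I s r)
    then show ?case using forms_alternating[OF *] by (simp add: alternating_swap)
  next
    case (4 c c' p I)
    then show ?case
      using forms_change[OF *, of c c' p I] by (simp add: sum_distrib_left mult.left_commute)
  qed
qed


section \<open>The pairing of forms\<close>

text \<open>The complete contraction computed in the chart \<open>c\<close>. In \<open>contraction\<close> the chart is chosen anew at
  every point, so continuity becomes visible only once the value is known not to depend on it.\<close>

definition chart_contraction ::
    "('a, 'n::finite) metric_field \<Rightarrow> nat \<Rightarrow> ('a, 'n) field \<Rightarrow> ('a, 'n) field \<Rightarrow>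
     ('a, 'n) chart \<Rightarrow> 'a \<Rightarrow> real"
  where "chart_contraction g k \<phi> \<psi> c p =
    (\<Sum>I\<in>lists_of_length k. \<Sum>L\<in>lists_of_length k.
       (\<Prod>r<k. ginv g c p $ (I ! r) $ (L ! r)) * \<phi> c p I * \<psi> c p L)"

lemma matrix_inv_cancel:
  assumes "invertible A"
  shows "A ** matrix_inv A = mat 1" "matrix_inv A ** A = mat 1"
  using someI_ex[OF assms[unfolded invertible_def]] by (simp_all add: matrix_inv_def)

lemma matrix_inv_eqI:
  fixes A B :: "real ^ 'n::finite ^ 'n"
  assumes "B ** A = mat 1"
  shows "matrix_inv A = B"
proof -
  have "A ** B = mat 1" using assms matrix_left_right_inverse by blast
  then have "invertible A" using assms by (auto simp: invertible_def)
  then have "A ** matrix_inv A = mat 1" by (simp add: matrix_inv_cancel)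
  then have "B ** (A ** matrix_inv A) = B" by simp
  then show ?thesis by (simp add: matrix_mul_assoc assms)
qed

text \<open>With the Jacobian \<open>j\<close>, the transformation law \<open>g = j\<^sup>T g' j\<close> exhibits \<open>g\<inverse> j\<^sup>T g'\<close> as a left inverse
  of \<open>j\<close>, hence as a right inverse, which says that \<open>j g\<inverse> j\<^sup>T\<close> inverts \<open>g'\<close>.\<close>

lemma ginv_change:
  assumes g: "pseudo_riemannian_metric A g"
    and "c \<in> A" "c' \<in> A" "p \<in> chart_dom c \<inter> chart_dom c'"
  shows "ginv g c' p = jac c c' p ** ginv g c p ** transpose (jac c c' p)"
proof (rule matrix_inv_eqI)
  let ?J = "jac c c' p"
  have change: "g c p = transpose ?J ** g c' p ** ?J" and inv: "invertible (g c p)"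
    using assms unfolding pseudo_riemannian_metric_def by blast+
  have "ginv g c p ** g c p = mat 1"
    using inv by (simp add: matrix_inv_cancel)
  then have "(ginv g c p ** transpose ?J ** g c' p) ** ?J = mat 1"
    by (simp add: change matrix_mul_assoc)
  then have "?J ** (ginv g c p ** transpose ?J ** g c' p) = mat 1"
    using matrix_left_right_inverse by blast
  then show "?J ** ginv g c p ** transpose ?J ** g c' p = mat 1"
    by (simp add: matrix_mul_assoc)
qed

lemma chart_contraction_change:
  fixes A :: "('a::{t2_space, second_countable_topology}, 'n::finite) chart set"
  assumes g: "pseudo_riemannian_metric A g"
    and \<phi>: "\<phi> \<in> forms A k" and \<psi>: "\<psi> \<in> forms A k"
    and c: "c \<in> A" "c' \<in> A" "p \<in> chart_dom c \<inter> chart_dom c'"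
  shows "chart_contraction g k \<phi> \<psi> c p = chart_contraction g k \<phi> \<psi> c' p"
proof -
  define J where "J = (\<lambda>l i. jac c c' p $ l $ i)"
  define K where "K = (\<lambda>i j. ginv g c p $ i $ j)"
  define X where "X = (lists_of_length k :: 'n list set)"
  have K': "ginv g c' p $ M $ N = (\<Sum>i\<in>UNIV. \<Sum>j\<in>UNIV. K i j * J M i * J N j)" for M N
  proof -
    have "ginv g c' p $ M $ N = (\<Sum>j\<in>UNIV. (\<Sum>i\<in>UNIV. J M i * K i j) * J N j)"
      by (simp add: ginv_change[OF g c] matrix_matrix_mult_def transpose_def J_def K_def)
    also have "\<dots> = (\<Sum>i\<in>UNIV. \<Sum>j\<in>UNIV. K i j * J M i * J N j)"
      by (subst sum.swap) (simp add: sum_distrib_left sum_distrib_right mult_ac)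
    finally show ?thesis .
  qed
  have prodsum: "(\<Sum>I\<in>X. \<Sum>L\<in>X. (\<Prod>r<k. K (I ! r) (L ! r)) *
      (\<Prod>r<k. J (M ! r) (I ! r)) * (\<Prod>r<k. J (N ! r) (L ! r))) =
      (\<Prod>r<k. ginv g c' p $ (M ! r) $ (N ! r))" for M N :: "'n list"
  proof -
    have "(\<Sum>I\<in>X. \<Sum>L\<in>X. (\<Prod>r<k. K (I ! r) (L ! r)) *
        (\<Prod>r<k. J (M ! r) (I ! r)) * (\<Prod>r<k. J (N ! r) (L ! r))) =
        (\<Sum>I\<in>X. \<Sum>L\<in>X. \<Prod>r<k. (\<lambda>b. K (I ! r) b * J (M ! r) (I ! r) * J (N ! r) b) (L ! r))"
      by (simp add: prod.distrib)
    also have "\<dots> = (\<Sum>I\<in>X. \<Prod>r<k. \<Sum>b\<in>UNIV. K (I ! r) b * J (M ! r) (I ! r) * J (N ! r) b)"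
      unfolding X_def by (intro sum.cong refl sum_lists_prod_nth)
    also have "\<dots> = (\<Prod>r<k. \<Sum>a\<in>UNIV. \<Sum>b\<in>UNIV. K a b * J (M ! r) a * J (N ! r) b)"
      unfolding X_def
      by (rule sum_lists_prod_nth[where f = "\<lambda>r a. \<Sum>b\<in>UNIV. K a b * J (M ! r) a * J (N ! r) b"])
    finally show ?thesis by (simp add: K')
  qed
  have "chart_contraction g k \<phi> \<psi> c p = (\<Sum>I\<in>X. \<Sum>L\<in>X. (\<Prod>r<k. K (I ! r) (L ! r)) *
      (\<Sum>M\<in>X. (\<Prod>r<k. J (M ! r) (I ! r)) * \<phi> c' p M) *
      (\<Sum>N\<in>X. (\<Prod>r<k. J (N ! r) (L ! r)) * \<psi> c' p N))"
    unfolding chart_contraction_def K_def J_def X_def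
    by (intro sum.cong refl) (simp add: forms_change[OF \<phi> c] forms_change[OF \<psi> c])
  also have "\<dots> = (\<Sum>I\<in>X. \<Sum>L\<in>X. \<Sum>M\<in>X. \<Sum>N\<in>X. ((\<Prod>r<k. K (I ! r) (L ! r)) *
      (\<Prod>r<k. J (M ! r) (I ! r)) * (\<Prod>r<k. J (N ! r) (L ! r))) * (\<phi> c' p M * \<psi> c' p N))"
    by (simp add: sum_product sum_distrib_left mult_ac)
  also have "\<dots> = (\<Sum>I\<in>X. \<Sum>M\<in>X. \<Sum>N\<in>X. \<Sum>L\<in>X. ((\<Prod>r<k. K (I ! r) (L ! r)) *
      (\<Prod>r<k. J (M ! r) (I ! r)) * (\<Prod>r<k. J (N ! r) (L ! r))) * (\<phi> c' p M * \<psi> c' p N))"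
    by (rule sum.cong[OF refl], subst sum.swap, rule sum.cong[OF refl], rule sum.swap)
  also have "\<dots> = (\<Sum>M\<in>X. \<Sum>N\<in>X. \<Sum>I\<in>X. \<Sum>L\<in>X. ((\<Prod>r<k. K (I ! r) (L ! r)) *
      (\<Prod>r<k. J (M ! r) (I ! r)) * (\<Prod>r<k. J (N ! r) (L ! r))) * (\<phi> c' p M * \<psi> c' p N))"
    by (subst sum.swap, rule sum.cong[OF refl], rule sum.swap)
  also have "\<dots> = chart_contraction g k \<phi> \<psi> c' p"
    unfolding sum_distrib_right[symmetric] prodsum
    by (simp add: chart_contraction_def X_def mult.assoc)
  finally show ?thesis .
qed

lemma contraction_eq_chart_contraction:
  fixes A :: "('a::{t2_space, second_countable_topology}, 'n::finite) chart set"
  assumes "pseudo_riemannian_metric A g" "\<phi> \<in> forms A k" "\<psi> \<in> forms A k"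
    and "c \<in> A" "p \<in> chart_dom c"
  shows "contraction A g k \<phi> \<psi> p = chart_contraction g k \<phi> \<psi> c p"
proof -
  define c' where "c' = (SOME c. c \<in> A \<and> p \<in> chart_dom c)"
  have "c' \<in> A \<and> p \<in> chart_dom c'"
    unfolding c'_def by (rule someI[of _ c]) (use assms in simp)
  then show ?thesis
    using chart_contraction_change[OF assms(1-3) _ assms(4), of c' p] assms
    by (simp add: contraction_def chart_contraction_def Let_def flip: c'_def)
qed

lemma continuous_on_det:
  fixes M :: "'x::topological_space \<Rightarrow> real ^ 'n::finite ^ 'n"
  assumes "\<And>i j. continuous_on S (\<lambda>x. M x $ i $ j)"
  shows "continuous_on S (\<lambda>x. det (M x))"
  unfolding det_def by (intro continuous_intros assms)

text \<open>By Cramer's rule the entries of the inverse are quotients of determinants.\<close>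

lemma continuous_on_matrix_inv:
  fixes M :: "'x::topological_space \<Rightarrow> real ^ 'n::finite ^ 'n"
  assumes M: "\<And>i j. continuous_on S (\<lambda>x. M x $ i $ j)"
    and inv: "\<And>x. x \<in> S \<Longrightarrow> invertible (M x)"
  shows "continuous_on S (\<lambda>x. matrix_inv (M x) $ i $ j)"
proof -
  define N where "N = (\<lambda>x. (\<chi> a b. if b = i then axis j 1 $ a else M x $ a $ b) :: real ^ 'n ^ 'n)"
  have "matrix_inv (M x) $ i $ j = det (N x) / det (M x)" if "x \<in> S" for x
  proof -
    have "M x *v (matrix_inv (M x) *v axis j 1) = axis j 1"
      using inv[OF that] by (simp add: matrix_vector_mul_assoc matrix_inv_cancel)
    then have "matrix_inv (M x) *v axis j 1 =
        (\<chi> k. det (\<chi> a b. if b = k then axis j 1 $ a else M x $ a $ b) / det (M x))"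
      using inv[OF that] by (subst (asm) cramer) (auto simp: invertible_det_nz)
    then have "(matrix_inv (M x) *v axis j 1) $ i = det (N x) / det (M x)"
      by (simp add: N_def)
    then show ?thesis
      by (simp add: matrix_vector_mul_component inner_axis)
  qed
  moreover have "continuous_on S (\<lambda>x. N x $ a $ b)" for a b
    by (cases "b = i") (simp_all add: N_def M)
  then have "continuous_on S (\<lambda>x. det (N x) / det (M x))"
    using inv by (intro continuous_on_divide continuous_on_det M) (auto simp: invertible_det_nz)
  ultimately show ?thesis
    using continuous_on_cong by force
qed

lemma metric_continuous:
  assumes "pseudo_riemannian_metric A g" "c \<in> A"
  shows "continuous_on (coords c ` chart_dom c) (\<lambda>x. g c (uncoords c x) $ i $ j)"
  using assms smooth_on_continuous_on unfolding pseudo_riemannian_metric_def by blast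

lemma continuous_on_contraction:
  fixes A :: "('a::{t2_space, second_countable_topology}, 'n::finite) chart set"
  assumes A: "smooth_atlas A" and g: "pseudo_riemannian_metric A g"
    and \<phi>: "\<phi> \<in> forms A k" and \<psi>: "\<psi> \<in> forms A k"
  shows "continuous_on UNIV (contraction A g k \<phi> \<psi>)"
proof -
  have "continuous_on (chart_dom c) (contraction A g k \<phi> \<psi>)" if c: "c \<in> A" for c
  proof -
    let ?S = "coords c ` chart_dom c"
    have u: "uncoords c x \<in> chart_dom c" if "x \<in> ?S" for x
      using that atlas_uncoords[OF A c] by auto
    have "invertible (g c (uncoords c x))" if "x \<in> ?S" for x
      using g c u[OF that] unfolding pseudo_riemannian_metric_def by blast
    then have "continuous_on ?S (\<lambda>x. ginv g c (uncoords c x) $ i $ j)" for i j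
      by (intro continuous_on_matrix_inv metric_continuous[OF g c])
    moreover have "continuous_on ?S (\<lambda>x. \<phi> c (uncoords c x) I)"
      "continuous_on ?S (\<lambda>x. \<psi> c (uncoords c x) I)" for I
      using smooth_on_continuous_on[OF forms_smooth[OF \<phi> c]]
        smooth_on_continuous_on[OF forms_smooth[OF \<psi> c]] by blast+
    ultimately have "continuous_on ?S (\<lambda>x. chart_contraction g k \<phi> \<psi> c (uncoords c x))"
      unfolding chart_contraction_def
      by (intro continuous_on_sum continuous_on_mult continuous_on_prod)
    moreover have "continuous_on (chart_dom c) (coords c)"
      using atlas_chart(3)[OF A c] by (simp add: homeomorphism_def)
    ultimately have "continuous_on (chart_dom c)
        (\<lambda>p. chart_contraction g k \<phi> \<psi> c (uncoords c (coords c p)))"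
      by (rule continuous_on_compose2) simp
    then show ?thesis
      by (rule continuous_on_cong[THEN iffD1, rotated 2])
        (simp_all add: atlas_uncoords[OF A c] contraction_eq_chart_contraction[OF g \<phi> \<psi> c])
  qed
  then have "continuous_on (\<Union>c\<in>A. chart_dom c) (contraction A g k \<phi> \<psi>)"
    using atlas_chart(1)[OF A] by (intro continuous_on_open_UN) auto
  then show ?thesis
    using A by (simp add: smooth_atlas_def)
qed

text \<open>On a coordinate ball whose closure lies in the chart the density \<open>\<surd>\<bar>det g\<bar>\<close> is bounded.\<close>

lemma locally_finite_volume:
  fixes A :: "('a::{t2_space, second_countable_topology}, 'n::finite) chart set"
  assumes A: "smooth_atlas A" and g: "pseudo_riemannian_metric A g" and \<mu>: "volume_measure A g \<mu>"
  shows "\<exists>B. open B \<and> p \<in> B \<and> emeasure \<mu> B < \<infinity>"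
proof -
  obtain c where c: "c \<in> A" "p \<in> chart_dom c"
    using A unfolding smooth_atlas_def by blast
  let ?S = "coords c ` chart_dom c"
  note hom = atlas_chart(3)[OF A c(1)]
  obtain e where e: "e > 0" "cball (coords c p) e \<subseteq> ?S"
    using open_contains_cball atlas_chart(2)[OF A c(1)] c(2) by blast
  define D where "D = ball (coords c p) e"
  define B where "B = chart_dom c \<inter> coords c -` D"
  have "open B"
    unfolding B_def using hom atlas_chart(1)[OF A c(1)]
    by (intro continuous_open_preimage) (auto simp: homeomorphism_def D_def)
  have D: "coords c ` B = D"
    using order_trans[OF ball_subset_cball e(2)] unfolding B_def D_def by blast
  have "continuous_on ?S (\<lambda>x. sqrt \<bar>det (g c (uncoords c x))\<bar>)"
    by (intro continuous_intros continuous_on_det metric_continuous[OF g c(1)])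
  then have "continuous_on (cball (coords c p) e) (\<lambda>x. sqrt \<bar>det (g c (uncoords c x))\<bar>)"
    using e(2) continuous_on_subset by blast
  then have "bounded ((\<lambda>x. sqrt \<bar>det (g c (uncoords c x))\<bar>) ` cball (coords c p) e)"
    by (intro compact_imp_bounded compact_continuous_image) auto
  then obtain K where K: "\<And>x. x \<in> D \<Longrightarrow> sqrt \<bar>det (g c (uncoords c x))\<bar> \<le> K"
    unfolding bounded_iff D_def by (fastforce simp: abs_le_iff)
  have "emeasure \<mu> B = (\<integral>\<^sup>+x\<in>coords c ` B. ennreal (sqrt \<bar>det (g c (uncoords c x))\<bar>) \<partial>lborel)"
    using \<mu> c(1) \<open>open B\<close> unfolding volume_measure_def by (auto simp: B_def)
  also have "\<dots> \<le> (\<integral>\<^sup>+x. ennreal K * indicator D x \<partial>lborel)"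
    unfolding D by (intro nn_integral_mono) (auto simp: indicator_def K intro!: ennreal_leI)
  also have "\<dots> = ennreal K * emeasure lborel D"
    by (rule nn_integral_cmult_indicator) (simp add: D_def)
  also have "\<dots> < \<infinity>"
    unfolding D_def using emeasure_lborel_ball_finite[of "coords c p" e]
    by (simp add: ennreal_mult_less_top)
  finally show ?thesis
    using \<open>open B\<close> c(2) e(1) by (intro exI[of _ B]) (simp add: B_def D_def)
qed

lemma finite_volume:
  fixes A :: "('a::{t2_space, second_countable_topology}, 'n::finite) chart set"
  assumes A: "smooth_atlas A" and M: "compact (UNIV :: 'a set)"
    and g: "pseudo_riemannian_metric A g" and \<mu>: "volume_measure A g \<mu>"
  shows "finite_measure \<mu>"
proof
  have sets: "sets \<mu> = sets borel" using \<mu> by (simp add: volume_measure_def)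
  define \<B> where "\<B> = {B. open B \<and> emeasure \<mu> B < \<infinity>}"
  have "UNIV \<subseteq> \<Union>\<B>"
    using locally_finite_volume[OF A g \<mu>] by (auto simp: \<B>_def)
  moreover have "\<forall>B\<in>\<B>. open B" by (simp add: \<B>_def)
  ultimately obtain \<F> where \<F>: "\<F> \<subseteq> \<B>" "finite \<F>" "UNIV \<subseteq> \<Union>\<F>"
    using compactE[OF M] by metis
  have "space \<mu> = UNIV" using sets_eq_imp_space_eq[OF sets] by simp
  then have "emeasure \<mu> (space \<mu>) = emeasure \<mu> (\<Union>B\<in>\<F>. B)"
    using \<F>(3) by (simp add: top.extremum_unique)
  also have "\<dots> \<le> (\<Sum>B\<in>\<F>. emeasure \<mu> B)"
    using \<F> by (intro emeasure_subadditive_finite) (auto simp: sets \<B>_def)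
  also have "\<dots> < \<infinity>"
    using \<F> by (auto simp: \<B>_def less_top)
  finally show "emeasure \<mu> (space \<mu>) \<noteq> \<infinity>" by simp
qed

text \<open>Additivity of the pairing rests on this, because the integral of a function that is not integrable is
  0 by convention.\<close>

lemma integrable_contraction:
  fixes A :: "('a::{t2_space, second_countable_topology}, 'n::finite) chart set"
  assumes A: "smooth_atlas A" and M: "compact (UNIV :: 'a set)"
    and g: "pseudo_riemannian_metric A g" and \<mu>: "volume_measure A g \<mu>"
    and "\<phi> \<in> forms A k" "\<psi> \<in> forms A k"
  shows "integrable \<mu> (contraction A g k \<phi> \<psi>)"
proof -
  have cont: "continuous_on UNIV (contraction A g k \<phi> \<psi>)"
    by (rule continuous_on_contraction) (use assms in auto)
  then have "bounded (contraction A g k \<phi> \<psi> ` UNIV)"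
    by (rule compact_imp_bounded[OF compact_continuous_image[OF _ M]])
  then obtain K where "\<And>p. norm (contraction A g k \<phi> \<psi> p) \<le> K"
    unfolding bounded_iff by blast
  moreover have "contraction A g k \<phi> \<psi> \<in> borel_measurable \<mu>"
    using borel_measurable_continuous_onI[OF cont] \<mu>
    by (simp add: volume_measure_def cong: measurable_cong_sets)
  ultimately show ?thesis
    by (intro finite_measure.integrable_const_bound[OF finite_volume[OF A M g \<mu>], of _ K]) auto
qed

lemma pairing_add:
  fixes A :: "('a::{t2_space, second_countable_topology}, 'n::finite) chart set"
  assumes "smooth_atlas A" "compact (UNIV :: 'a set)"
    "pseudo_riemannian_metric A g" "volume_measure A g \<mu>"
    and "\<phi> \<in> forms A k" "\<phi>' \<in> forms A k" "\<psi> \<in> forms A k"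
  shows "pairing A g \<mu> k (\<phi> + \<phi>') \<psi> = pairing A g \<mu> k \<phi> \<psi> + pairing A g \<mu> k \<phi>' \<psi>"
proof -
  have "contraction A g k (\<phi> + \<phi>') \<psi> = (\<lambda>p. contraction A g k \<phi> \<psi> p + contraction A g k \<phi>' \<psi> p)"
    by (simp add: contraction_def Let_def ring_distribs sum.distrib fun_eq_iff)
  then show ?thesis
    unfolding pairing_def using integrable_contraction[OF assms(1-4)] assms(5-) by simp
qed

lemma contraction_scale:
  "contraction A g k (a *\<^sub>R \<phi>) \<psi> p = a * contraction A g k \<phi> \<psi> p"
  "contraction A g k \<phi> (a *\<^sub>R \<psi>) p = a * contraction A g k \<phi> \<psi> p"
  by (simp_all add: contraction_def Let_def scaleR_fun_def sum_distrib_left mult_ac)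

lemma pairing_scale:
  "pairing A g \<mu> k (a *\<^sub>R \<phi>) \<psi> = a * pairing A g \<mu> k \<phi> \<psi>"
  "pairing A g \<mu> k \<phi> (a *\<^sub>R \<psi>) = a * pairing A g \<mu> k \<phi> \<psi>"
  by (simp_all add: pairing_def contraction_scale fun_eq_iff)


section \<open>Eigenvectors of products of shifted endomorphisms\<close>

locale endomorphism =
  fixes V :: "'v::real_vector set" and T :: "'v \<Rightarrow> 'v"
  assumes V: "subspace V"
    and T_closed: "f \<in> V \<Longrightarrow> T f \<in> V"
    and T_add: "f \<in> V \<Longrightarrow> f' \<in> V \<Longrightarrow> T (f + f') = T f + T f'"
    and T_scale: "f \<in> V \<Longrightarrow> T (a *\<^sub>R f) = a *\<^sub>R T f"
begin

definition shift_prod :: "real list \<Rightarrow> 'v \<Rightarrow> 'v"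
  where "shift_prod as = foldr (\<lambda>a F. (\<lambda>f. T f + a *\<^sub>R f) \<circ> F) as id"

lemma shift_prod_simps [simp]:
  "shift_prod [] f = f"
  "shift_prod (a # as) f = T (shift_prod as f) + a *\<^sub>R shift_prod as f"
  by (simp_all add: shift_prod_def)

lemma shift_prod_closed: "f \<in> V \<Longrightarrow> shift_prod as f \<in> V"
  by (induction as) (auto intro: subspace_add subspace_scale V T_closed)

lemma shift_prod_add:
  "f \<in> V \<Longrightarrow> f' \<in> V \<Longrightarrow> shift_prod as (f + f') = shift_prod as f + shift_prod as f'"
  by (induction as) (auto simp: T_add shift_prod_closed algebra_simps)

lemma shift_prod_scale: "f \<in> V \<Longrightarrow> shift_prod as (a *\<^sub>R f) = a *\<^sub>R shift_prod as f"
  by (induction as) (auto simp: T_scale shift_prod_closed algebra_simps)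

lemma shift_prod_zero: "shift_prod as 0 = 0"
  using shift_prod_scale[of 0 as 0] subspace_0[OF V] by simp

lemma shift_prod_sum:
  assumes "\<And>i. i \<in> I \<Longrightarrow> f i \<in> V"
  shows "shift_prod as (\<Sum>i\<in>I. f i) = (\<Sum>i\<in>I. shift_prod as (f i))"
  using assms
proof (induction I rule: infinite_finite_induct)
  case (insert i I)
  then have "(\<Sum>i\<in>I. f i) \<in> V" by (auto intro: subspace_sum V)
  then show ?case using insert by (simp add: shift_prod_add)
qed (simp_all add: shift_prod_zero)

lemma shift_prod_eigenvector:
  assumes "f \<in> V" "T f = (- b) *\<^sub>R f"
  shows "shift_prod as f = (\<Prod>a\<leftarrow>as. a - b) *\<^sub>R f"
  by (induction as) (auto simp: T_scale assms algebra_simps)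

text \<open>Peel off the outermost factor \<open>T + a\<close>. Let \<open>R\<close> be the product of the remaining factors. Then
  \<open>R f\<close> is an eigenvector for \<open>- a\<close>, on which \<open>R\<close> acts by the nonzero number \<open>\<kappa>\<close>. So \<open>R\<close> kills
  \<open>f - R f / \<kappa>\<close>, to which the induction hypothesis applies.\<close>

lemma eigenvector_decomposition:
  assumes "distinct as" "f \<in> V" "shift_prod as f = 0"
  shows "\<exists>w. (\<forall>a\<in>set as. w a \<in> V \<and> T (w a) = (- a) *\<^sub>R w a) \<and> f = (\<Sum>a\<in>set as. w a)"
  using assms
proof (induction as arbitrary: f)
  case Nil
  then show ?case by simp
next
  case (Cons a as)
  define g where "g = shift_prod as f"
  define \<kappa> where "\<kappa> = (\<Prod>a'\<leftarrow>as. a' - a)"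
  have g: "g \<in> V" "T g = (- a) *\<^sub>R g"
    using Cons.prems by (auto simp: g_def shift_prod_closed eq_neg_iff_add_eq_0)
  have \<kappa>: "\<kappa> \<noteq> 0"
    using Cons.prems by (auto simp: \<kappa>_def prod_list_zero_iff)
  define h where "h = (1 / \<kappa>) *\<^sub>R g"
  have h: "h \<in> V" "T h = (- a) *\<^sub>R h"
    using g V by (auto simp: h_def subspace_scale T_scale)
  have "shift_prod as (f + (-1) *\<^sub>R h) = 0"
  proof -
    have "shift_prod as h = g"
      using \<kappa> by (simp add: h_def shift_prod_scale[OF g(1)] shift_prod_eigenvector[OF g]
          flip: \<kappa>_def)
    then show ?thesis
      using Cons.prems h V
      by (subst shift_prod_add) (auto simp: subspace_neg shift_prod_scale[of h as "-1", simplified] g_def)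
  qed
  moreover have "f + (-1) *\<^sub>R h \<in> V" "distinct as"
    using Cons.prems h V by (auto intro: subspace_diff)
  ultimately obtain w where w: "\<forall>a\<in>set as. w a \<in> V \<and> T (w a) = (- a) *\<^sub>R w a"
    "f + (-1) *\<^sub>R h = (\<Sum>a\<in>set as. w a)"
    using Cons.IH by blast
  have "(\<Sum>b\<in>set as. (w(a := h)) b) = (\<Sum>b\<in>set as. w b)"
    using Cons.prems by (intro sum.cong) auto
  then have "f = (\<Sum>b\<in>set (a # as). (w(a := h)) b)"
    using Cons.prems w(2) by (simp add: algebra_simps)
  moreover have "\<forall>b\<in>set (a # as). (w(a := h)) b \<in> V \<and> T ((w(a := h)) b) = (- b) *\<^sub>R (w(a := h)) b"
    using w(1) h by auto
  ultimately show ?case by blast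
qed

text \<open>The product over the tail of the list kills all summands but the first, which it multiplies by a
  nonzero number.\<close>

lemma eigenvectors_independent:
  assumes "distinct as" "\<And>a. a \<in> set as \<Longrightarrow> w a \<in> V \<and> T (w a) = (- a) *\<^sub>R w a"
    and "(\<Sum>a\<in>set as. w a) = 0" "a \<in> set as"
  shows "w a = 0"
  using assms
proof (induction as arbitrary: a)
  case Nil
  then show ?case by simp
next
  case (Cons b as)
  have eig: "shift_prod as (w a) = (\<Prod>a'\<leftarrow>as. a' - a) *\<^sub>R w a" if "a \<in> set (b # as)" for a
    using Cons.prems(2)[OF that] by (intro shift_prod_eigenvector) auto
  have "shift_prod as (\<Sum>a\<in>set (b # as). w a) = (\<Sum>a\<in>set (b # as). shift_prod as (w a))"
    using Cons.prems(2) by (intro shift_prod_sum) auto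
  also have "\<dots> = (\<Prod>a'\<leftarrow>as. a' - b) *\<^sub>R w b"
  proof -
    have "shift_prod as (w a) = 0" if "a \<in> set as" for a
      using eig[of a] that by (auto simp: prod_list_zero_iff)
    then show ?thesis
      using Cons.prems(1) eig[of b] by simp
  qed
  finally have "(\<Prod>a'\<leftarrow>as. a' - b) *\<^sub>R w b = 0"
    using Cons.prems(3) by (simp only: shift_prod_zero)
  moreover have "(\<Prod>a'\<leftarrow>as. a' - b) \<noteq> 0"
    using Cons.prems(1) by (auto simp: prod_list_zero_iff)
  ultimately have b: "w b = 0" by simp
  show ?case
  proof (cases "a = b")
    case False
    then show ?thesis
      using Cons.prems b by (intro Cons.IH) auto
  qed (use b in simp)
qed

end


section \<open>The coefficients\<close>

text \<open>Tracing \<open>Ric = l g\<close> gives \<open>Sc = n l\<close>, and \<open>l = 0\<close> would mean that \<open>g\<close> is Ricci flat.\<close>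

lemma schouten_trace_nonzero:
  fixes A :: "('a::{t2_space, second_countable_topology}, 'n::finite) chart set"
  assumes n: "CARD('n) \<ge> 2" and g: "pseudo_riemannian_metric A g"
    and "einstein A g" "\<not> ricci_flat A g"
    and J: "\<forall>c\<in>A. \<forall>p\<in>chart_dom c. schouten_trace g c p = J"
  shows "J \<noteq> 0"
proof -
  obtain l where l: "\<forall>c\<in>A. \<forall>p\<in>chart_dom c. ricci g c p = l *\<^sub>R g c p"
    using assms(3) by (auto simp: einstein_def)
  obtain c p where c: "c \<in> A" "p \<in> chart_dom c" "ricci g c p \<noteq> 0"
    using assms(4) unfolding ricci_flat_def by blast
  have l0: "l \<noteq> 0" and ric: "ricci g c p = l *\<^sub>R g c p"
    using l c by auto
  have "transpose (g c p) = g c p" and inv: "invertible (g c p)"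
    using g c unfolding pseudo_riemannian_metric_def by blast+
  then have sym: "g c p $ a $ b = g c p $ b $ a" for a b
    by (metis transpose_def vec_lambda_beta)
  have "scalar_curvature g c p = l * (\<Sum>a\<in>UNIV. \<Sum>b\<in>UNIV. ginv g c p $ a $ b * g c p $ b $ a)"
    by (simp add: scalar_curvature_def ric sum_distrib_left mult_ac sym[of _ _])
  also have "(\<Sum>a\<in>UNIV. \<Sum>b\<in>UNIV. ginv g c p $ a $ b * g c p $ b $ a) =
      (\<Sum>a\<in>UNIV. (ginv g c p ** g c p) $ a $ a)"
    by (simp add: matrix_matrix_mult_def)
  also have "\<dots> = real CARD('n)"
    by (simp add: matrix_inv_cancel[OF inv] mat_def)
  finally have "scalar_curvature g c p = l * real CARD('n)" .
  moreover have "J = scalar_curvature g c p / (2 * (real CARD('n) - 1))"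
    using J[rule_format, OF c(1,2)] by (simp add: schouten_trace_def)
  ultimately have "J = l * real CARD('n) / (2 * (real CARD('n) - 1))"
    by simp
  then show ?thesis
    using l0 n by auto
qed

text \<open>With \<open>N = n - 2k\<close>, \<open>j (N - j + 1) - i (N - i + 1) = (j - i) (N + 1 - i - j)\<close>, and \<open>i + j < N\<close> because
  \<open>i < j \<le> N/2\<close>.\<close>

lemma coef_strict_mono:
  assumes "2 * k \<le> n" "n > 0" "i < j" "j \<le> (n - 2 * k) div 2"
  shows "coef n k i < coef n k j"
proof -
  have N: "real n - 2 * real k = real (n - 2 * k)"
    using assms(1) by (simp add: of_nat_diff)
  have "real i + real j < real (n - 2 * k) + 1"
    using assms by linarith
  then have "0 < (real j - real i) * (real (n - 2 * k) + 1 - real i - real j)"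
    using assms by (intro mult_pos_pos) auto
  then have "real i * (real (n - 2 * k) - real i + 1) < real j * (real (n - 2 * k) - real j + 1)"
    by (simp add: algebra_simps)
  then show ?thesis
    using assms(2) by (simp add: coef_def N divide_strict_right_mono mult.assoc)
qed

lemma coef_0 [simp]: "coef n k 0 = 0"
  by (simp add: coef_def)


section \<open>Harmonic and exact forms\<close>

text \<open>Uniqueness of the decomposition makes the definite description in \<open>sum_projection\<close> evaluate to
  \<open>w\<close>.\<close>

lemma sum_projectionI:
  assumes "direct_sum V I W" "w \<in> Pi\<^sub>E I W"
  shows "sum w I \<in> V" "sum_projection I W i (sum w I) = w i"
proof -
  show "sum w I \<in> V"
    using assms unfolding direct_sum_def by (intro subspace_sum) (auto simp: PiE_def Pi_def)
  then have "(THE w'. w' \<in> Pi\<^sub>E I W \<and> sum w I = sum w' I) = w"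
    using assms unfolding direct_sum_def by (intro the1_equality) auto
  then show "sum_projection I W i (sum w I) = w i"
    by (simp add: sum_projection_def)
qed

locale closed_manifold =
  fixes A :: "('a::{t2_space, second_countable_topology}, 'n::finite) chart set"
    and g :: "('a, 'n) metric_field"
    and \<mu> :: "'a measure"
    and \<delta> :: "('a, 'n) field \<Rightarrow> ('a, 'n) field"
  assumes A: "smooth_atlas A" and M: "compact (UNIV :: 'a set)"
    and g: "pseudo_riemannian_metric A g"
    and \<mu>: "volume_measure A g \<mu>"
    and \<delta>: "codifferential A g \<mu> \<delta>"
begin

abbreviation d :: "('a, 'n) field \<Rightarrow> ('a, 'n) field"
  where "d \<equiv> ext_deriv A"

lemma zero_in_forms: "0 \<in> forms A k"
  by (rule subspace_0[OF subspace_forms[OF A]])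

lemma d_zero [simp]: "d 0 = 0"
  using ext_deriv_linear(2)[OF A zero_in_forms zero_in_forms, of 0] by simp

lemma \<delta>_functions: "f \<in> forms A 0 \<Longrightarrow> \<delta> f = 0"
  and \<delta>_in_forms: "f \<in> forms A (Suc k) \<Longrightarrow> \<delta> f \<in> forms A k"
  and \<delta>_linear: "f \<in> forms A k \<Longrightarrow> f' \<in> forms A k \<Longrightarrow>
    \<delta> (a *\<^sub>R f + b *\<^sub>R f') = a *\<^sub>R \<delta> f + b *\<^sub>R \<delta> f'"
  and \<delta>_adjoint: "\<phi> \<in> forms A k \<Longrightarrow> \<psi> \<in> forms A (Suc k) \<Longrightarrow>
    pairing A g \<mu> (Suc k) (d \<phi>) \<psi> / fact (Suc k) = pairing A g \<mu> k \<phi> (\<delta> \<psi>) / fact k"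
  using \<delta> unfolding codifferential_def by blast+

lemma \<delta>_add: "f \<in> forms A k \<Longrightarrow> f' \<in> forms A k \<Longrightarrow> \<delta> (f + f') = \<delta> f + \<delta> f'"
  using \<delta>_linear[of f k f' 1 1] by simp

lemma \<delta>_scale: "f \<in> forms A k \<Longrightarrow> \<delta> (a *\<^sub>R f) = a *\<^sub>R \<delta> f"
  using \<delta>_linear[of f k f a 0] by simp

lemma \<delta>_zero [simp]: "\<delta> 0 = 0"
  using \<delta>_functions[OF zero_in_forms] .

lemma d\<delta>_in_closed_forms: "f \<in> forms A k \<Longrightarrow> d (\<delta> f) \<in> closed_forms A k"
proof (cases k)
  case 0
  assume "f \<in> forms A k"
  then show ?thesis
    using 0 \<delta>_functions[of f] zero_in_forms[of k] by (simp add: closed_forms_def)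
next
  case (Suc j)
  assume "f \<in> forms A k"
  then have "\<delta> f \<in> forms A j" using Suc \<delta>_in_forms by simp
  then show ?thesis
    using Suc ext_deriv_in_forms[OF A] ext_deriv_ext_deriv[OF A] by (simp add: closed_forms_def)
qed

lemma d\<delta>_linear:
  assumes "f \<in> forms A k" "f' \<in> forms A k"
  shows "d (\<delta> (f + f')) = d (\<delta> f) + d (\<delta> f')" "d (\<delta> (a *\<^sub>R f)) = a *\<^sub>R d (\<delta> f)"
proof -
  have "\<exists>j. \<delta> f \<in> forms A j \<and> \<delta> f' \<in> forms A j"
    using assms by (cases k) (auto simp: \<delta>_functions zero_in_forms intro: \<delta>_in_forms)
  then show "d (\<delta> (f + f')) = d (\<delta> f) + d (\<delta> f')" "d (\<delta> (a *\<^sub>R f)) = a *\<^sub>R d (\<delta> f)"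
    using ext_deriv_linear[OF A] \<delta>_add[OF assms] \<delta>_scale[OF assms(1)] by auto
qed

lemma closed_form_in_forms: "f \<in> closed_forms A k \<Longrightarrow> f \<in> forms A k"
  by (simp add: closed_forms_def)

lemma subspace_closed_forms: "subspace (closed_forms A k)"
proof (rule subspaceI)
  show "0 \<in> closed_forms A k"
    by (simp add: closed_forms_def zero_in_forms)
  show "f + f' \<in> closed_forms A k" if "f \<in> closed_forms A k" "f' \<in> closed_forms A k" for f f'
    using that subspace_add[OF subspace_forms[OF A]] ext_deriv_linear(1)[OF A, of f k f']
    by (simp add: closed_forms_def)
  show "a *\<^sub>R f \<in> closed_forms A k" if "f \<in> closed_forms A k" for a f
    using that subspace_scale[OF subspace_forms[OF A]] ext_deriv_linear(2)[OF A, of f k f a]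
    by (simp add: closed_forms_def)
qed

sublocale endomorphism "closed_forms A k" "\<lambda>f. d (\<delta> f)" for k
proof
  show "subspace (closed_forms A k)"
    by (rule subspace_closed_forms)
  fix f f' a assume f: "f \<in> closed_forms A k"
  show "d (\<delta> f) \<in> closed_forms A k"
    using f by (intro d\<delta>_in_closed_forms closed_form_in_forms)
  show "d (\<delta> (a *\<^sub>R f)) = a *\<^sub>R d (\<delta> f)"
    using f by (intro d\<delta>_linear(2)[of _ k f] closed_form_in_forms)
  assume "f' \<in> closed_forms A k"
  then show "d (\<delta> (f + f')) = d (\<delta> f) + d (\<delta> f')"
    using f by (intro d\<delta>_linear(1)[of _ k] closed_form_in_forms)
qed

lemma Q_op_eq_shift_prod:
  "Q_op A \<delta> J k = shift_prod (map (\<lambda>i. coef CARD('n) k i * J) [1..<Suc ((CARD('n) - 2 * k) div 2)])"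
  by (simp add: Q_op_def shift_prod_def foldr_map comp_def)

text \<open>The pairing with \<open>d \<phi>\<close> is, up to factorials, the pairing of \<open>\<phi>\<close> with \<open>\<delta> w = 0\<close>.\<close>

lemma pairing_exact_harmonic:
  assumes f: "f \<in> forms A k" and w: "w \<in> H_harm A \<delta> k"
  shows "pairing A g \<mu> k (d (\<delta> f)) w = 0"
proof (cases k)
  case 0
  then show ?thesis
    using f \<delta>_functions[of f] pairing_scale(1)[of A g \<mu> k 0 0 w] by simp
next
  case (Suc j)
  have "pairing A g \<mu> k (d (\<delta> f)) w / fact k = pairing A g \<mu> j (\<delta> f) (\<delta> w) / fact j"
    unfolding Suc using f w by (intro \<delta>_adjoint \<delta>_in_forms) (auto simp: H_harm_def Suc)
  also have "\<delta> w = 0" using w by (simp add: H_harm_def)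
  also have "pairing A g \<mu> j (\<delta> f) 0 = 0"
    using pairing_scale(2)[of A g \<mu> j "\<delta> f" 0 0] by simp
  finally show ?thesis by simp
qed

lemma pairing_sum:
  assumes "\<And>i. i \<in> I \<Longrightarrow> f i \<in> forms A k" "w \<in> forms A k"
  shows "pairing A g \<mu> k (\<Sum>i\<in>I. f i) w = (\<Sum>i\<in>I. pairing A g \<mu> k (f i) w)"
  using assms(1)
proof (induction I rule: infinite_finite_induct)
  case (insert i I)
  then have "(\<Sum>i\<in>I. f i) \<in> forms A k"
    by (auto intro: subspace_sum subspace_forms[OF A])
  then have "pairing A g \<mu> k (f i + (\<Sum>i\<in>I. f i)) w =
      pairing A g \<mu> k (f i) w + pairing A g \<mu> k (\<Sum>i\<in>I. f i) w"
    using insert.prems assms(2) by (intro pairing_add[OF A M g \<mu>]) auto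
  moreover have "pairing A g \<mu> k (\<Sum>i\<in>I. f i) w = (\<Sum>i\<in>I. pairing A g \<mu> k (f i) w)"
    using insert.prems by (intro insert.IH) auto
  ultimately show ?case
    by (simp only: sum.insert[OF insert.hyps])
qed (use pairing_scale(1)[of A g \<mu> k 0 0 w] in simp_all)

end


section \<open>The decomposition and the quadratic form\<close>

text \<open>The Einstein condition enters the decomposition only through the nonzero number \<open>J\<close>.\<close>

locale nonzero_schouten = closed_manifold A g \<mu> \<delta>
  for A :: "('a::{t2_space, second_countable_topology}, 'n::finite) chart set"
    and g \<mu> \<delta> +
  fixes J :: real and k :: nat
  assumes J: "J \<noteq> 0" and k: "2 * k \<le> CARD('n)"
begin

definition m :: nat where "m = (CARD('n) - 2 * k) div 2"

text \<open>The numbers \<open>- ev i\<close> are the eigenvalues of \<open>d \<delta>\<close> that occur. The index 0 is included on purpose: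
  \<open>ev 0 = 0\<close> belongs to the harmonic forms and comes from the extra factor \<open>d \<delta>\<close> in \<open>d \<delta> Q\<close>.\<close>

definition ev :: "nat \<Rightarrow> real" where "ev i = coef CARD('n) k i * J"

abbreviation Q :: "('a, 'n) field \<Rightarrow> ('a, 'n) field" where "Q \<equiv> Q_op A \<delta> J k"

abbreviation W :: "nat \<Rightarrow> ('a, 'n) field set" where "W \<equiv> summand A \<delta> J k"

lemma ev_0 [simp]: "ev 0 = 0"
  by (simp add: ev_def)

lemma inj_on_ev: "inj_on ev {0..m}"
proof (rule linorder_inj_onI')
  fix i j assume "i \<in> {0..m}" "j \<in> {0..m}" "i < j"
  then have "coef CARD('n) k i < coef CARD('n) k j"
    using k by (intro coef_strict_mono) (auto simp: m_def)
  then show "ev i \<noteq> ev j" using J by (simp add: ev_def)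
qed

lemma ev_nonzero: "i \<in> {1..m} \<Longrightarrow> ev i \<noteq> 0"
  using inj_onD[OF inj_on_ev, of i 0] by auto

lemma Q_eq: "Q = shift_prod (map ev [1..<Suc m])"
  unfolding Q_op_eq_shift_prod ev_def m_def ..

lemma Q_in_closed_forms: "f \<in> closed_forms A k \<Longrightarrow> Q f \<in> closed_forms A k"
  unfolding Q_eq by (rule shift_prod_closed)

lemma Q_eigenvector:
  assumes "f \<in> closed_forms A k" "d (\<delta> f) = (- b) *\<^sub>R f"
  shows "Q f = (\<Prod>i=1..m. ev i - b) *\<^sub>R f"
proof -
  have "(\<Prod>i\<leftarrow>[1..<Suc m]. ev i - b) = (\<Prod>i=1..m. ev i - b)"
    using prod.distinct_set_conv_list[of "[1..<Suc m]" "\<lambda>i. ev i - b"]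
    by (simp add: atLeastLessThanSuc_atLeastAtMost del: upt_Suc)
  then show ?thesis
    unfolding Q_eq shift_prod_eigenvector[OF assms] by (simp add: comp_def del: upt_Suc)
qed

definition Q_const :: real where "Q_const = (\<Prod>i=1..m. coef CARD('n) k i) * J ^ m"

lemma Q_const_eq: "Q_const = (\<Prod>i=1..m. ev i)"
  by (simp add: Q_const_def ev_def prod.distrib)

lemma Q_const_nonzero: "Q_const \<noteq> 0"
  using ev_nonzero by (simp add: Q_const_eq)

text \<open>The summands with \<open>i \<ge> 1\<close> consist of closed forms, as \<open>f = - d (\<delta> f) / ev i\<close> is exact.\<close>

lemma summand_eigenvector:
  assumes "i \<in> {0..m}" "f \<in> W i"
  shows "f \<in> closed_forms A k" "d (\<delta> f) = (- ev i) *\<^sub>R f"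
proof -
  have "f \<in> closed_forms A k \<and> d (\<delta> f) = (- ev i) *\<^sub>R f"
  proof (cases "i = 0")
    case True
    then show ?thesis
      using assms by (auto simp: summand_def H_harm_def closed_forms_def)
  next
    case False
    then have f: "f \<in> forms A k" "d (\<delta> f) = (- ev i) *\<^sub>R f" and "ev i \<noteq> 0"
      using assms ev_nonzero[of i] by (auto simp: summand_def H_eig_def ev_def)
    then have "f = (- (1 / ev i)) *\<^sub>R d (\<delta> f)" by simp
    then show ?thesis
      using f subspace_scale[OF subspace_closed_forms d\<delta>_in_closed_forms[OF f(1)]] by metis
  qed
  then show "f \<in> closed_forms A k" "d (\<delta> f) = (- ev i) *\<^sub>R f" by auto
qed

lemma Q_summand:
  assumes "i \<in> {0..m}" "f \<in> W i"
  shows "Q f = (\<Prod>j=1..m. ev j - ev i) *\<^sub>R f"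
  by (rule Q_eigenvector[OF summand_eigenvector[OF assms]])

lemma Q_summand_eq_0:
  assumes "i \<in> {1..m}" "f \<in> W i"
  shows "Q f = 0"
proof -
  have "(\<Prod>j=1..m. ev j - ev i) = 0"
    using assms(1) by (intro prod_zero) auto
  then show ?thesis
    using Q_summand[of i f] assms by simp
qed

lemma Q_harmonic: "f \<in> H_harm A \<delta> k \<Longrightarrow> Q f = Q_const *\<^sub>R f"
  using Q_summand[of 0 f] by (simp add: summand_def Q_const_eq)

lemma summand_subset_H_G:
  assumes "i \<in> {0..m}"
  shows "W i \<subseteq> H_G A \<delta> J k"
proof
  fix f assume f: "f \<in> W i"
  have "\<delta> (Q f) = 0"
  proof (cases "i = 0")
    case True
    then show ?thesis
      using f Q_harmonic[of f] \<delta>_scale[of f k Q_const] by (simp add: summand_def H_harm_def)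
  next
    case False
    then show ?thesis using Q_summand_eq_0[of i f] assms f by simp
  qed
  then show "f \<in> H_G A \<delta> J k"
    using summand_eigenvector[OF assms f] by (simp add: H_G_def)
qed

lemma subspace_summand: "subspace (W i)"
proof (rule subspaceI)
  note S = subspace_forms[OF A, of k]
  show "0 \<in> W i"
    by (simp add: summand_def H_harm_def H_eig_def zero_in_forms)
  fix f f' a
  assume f: "f \<in> W i"
  then have F: "f \<in> forms A k"
    by (simp add: summand_def H_harm_def H_eig_def split: if_splits)
  show "a *\<^sub>R f \<in> W i"
    using f subspace_scale[OF S F, of a] ext_deriv_linear(2)[OF A F F, of a] \<delta>_scale[OF F, of a]
      d\<delta>_linear(2)[OF F F, of a]
    by (simp add: summand_def H_harm_def H_eig_def scaleR_left_commute[of a] split: if_splits)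
  assume f': "f' \<in> W i"
  then have F': "f' \<in> forms A k"
    by (simp add: summand_def H_harm_def H_eig_def split: if_splits)
  show "f + f' \<in> W i"
    using f f' subspace_add[OF S F F'] ext_deriv_linear(1)[OF A F F'] \<delta>_add[OF F F']
      d\<delta>_linear(1)[OF F F']
    unfolding summand_def H_harm_def H_eig_def mem_Collect_eq
    by (auto simp only: scaleR_add_right add_0_left mem_Collect_eq split: if_splits)
qed

lemma subspace_H_G: "subspace (H_G A \<delta> J k)"
proof (rule subspaceI)
  note S = subspace_closed_forms[of k]
  show "0 \<in> H_G A \<delta> J k"
    using subspace_0[OF S] by (simp add: H_G_def Q_eq shift_prod_zero del: upt_Suc)
  fix f f' a assume f: "f \<in> H_G A \<delta> J k"
  then have F: "f \<in> closed_forms A k" by (simp add: H_G_def)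
  note QF = closed_form_in_forms[OF Q_in_closed_forms[OF F]]
  show "a *\<^sub>R f \<in> H_G A \<delta> J k"
    using f subspace_scale[OF S F, of a] \<delta>_scale[OF QF, of a]
    by (simp add: H_G_def Q_eq shift_prod_scale[OF F] del: upt_Suc)
  assume f': "f' \<in> H_G A \<delta> J k"
  then have F': "f' \<in> closed_forms A k" by (simp add: H_G_def)
  note QF' = closed_form_in_forms[OF Q_in_closed_forms[OF F']]
  have "Q (f + f') = Q f + Q f'"
    unfolding Q_eq by (rule shift_prod_add[OF F F'])
  then have "\<delta> (Q (f + f')) = \<delta> (Q f) + \<delta> (Q f')"
    using \<delta>_add[OF QF QF'] by simp
  then show "f + f' \<in> H_G A \<delta> J k"
    using f f' subspace_add[OF S F F'] unfolding H_G_def mem_Collect_eq by simp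
qed

lemma Q_sum_summands:
  assumes "\<And>i. i \<in> {0..m} \<Longrightarrow> v i \<in> closed_forms A k \<and> d (\<delta> (v i)) = (- ev i) *\<^sub>R v i"
  shows "Q (sum v {0..m}) = Q_const *\<^sub>R v 0"
proof -
  have "Q (sum v {0..m}) = (\<Sum>i\<in>{0..m}. Q (v i))"
    unfolding Q_eq using assms by (intro shift_prod_sum) auto
  also have "\<dots> = (\<Sum>i\<in>{0..m}. (\<Prod>j=1..m. ev j - ev i) *\<^sub>R v i)"
    using assms by (intro sum.cong refl Q_eigenvector) auto
  also have "\<dots> = (\<Sum>i\<in>{0}. (\<Prod>j=1..m. ev j - ev i) *\<^sub>R v i)"
  proof (rule sum.mono_neutral_right)
    show "\<forall>i\<in>{0..m} - {0}. (\<Prod>j=1..m. ev j - ev i) *\<^sub>R v i = 0"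
      by (auto intro!: bexI)
  qed auto
  finally show ?thesis by (simp add: Q_const_eq)
qed

text \<open>In \<open>d \<delta> Q f = 0\<close> a product of distinct shifts of \<open>d \<delta>\<close> is applied to \<open>f\<close>, so \<open>f\<close> is a sum of
  eigenvectors. For the summand \<open>v 0\<close> this gives only \<open>d \<delta> (v 0) = 0\<close>. That \<open>\<delta> (v 0) = 0\<close> uses the
  stronger hypothesis \<open>\<delta> Q f = 0\<close>, because \<open>Q f\<close> is a nonzero multiple of \<open>v 0\<close>.\<close>

lemma H_G_decomposition:
  assumes f: "f \<in> H_G A \<delta> J k"
  shows "\<exists>v. v \<in> Pi\<^sub>E {0..m} W \<and> f = sum v {0..m}"
proof -
  let ?evs = "map ev [0..<Suc m]"
  have F: "f \<in> closed_forms A k" "\<delta> (Q f) = 0" using f by (auto simp: H_G_def)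
  have set_evs: "set ?evs = ev ` {0..m}"
    by (auto simp: atLeastLessThanSuc_atLeastAtMost simp del: upt_Suc)
  have "distinct ?evs"
    using inj_on_ev by (simp add: distinct_map atLeastLessThanSuc_atLeastAtMost del: upt_Suc)
  moreover have "shift_prod ?evs f = 0"
  proof -
    have "?evs = ev 0 # map ev [1..<Suc m]"
      by (simp add: upt_conv_Cons del: upt_Suc)
    then have "shift_prod ?evs f = d (\<delta> (Q f)) + ev 0 *\<^sub>R Q f"
      by (simp only: shift_prod_simps Q_eq)
    then show ?thesis using F by simp
  qed
  ultimately obtain w where w: "\<And>a. a \<in> ev ` {0..m} \<Longrightarrow>
      w a \<in> closed_forms A k \<and> d (\<delta> (w a)) = (- a) *\<^sub>R w a" "f = (\<Sum>a\<in>ev ` {0..m}. w a)"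
    using eigenvector_decomposition[of ?evs f, OF _ F(1)] unfolding set_evs by blast
  define v where "v = (\<lambda>i\<in>{0..m}. w (ev i))"
  have v: "v i \<in> closed_forms A k \<and> d (\<delta> (v i)) = (- ev i) *\<^sub>R v i" if "i \<in> {0..m}" for i
    using w(1)[of "ev i"] that by (simp add: v_def)
  have f_sum: "f = sum v {0..m}"
    unfolding w(2) using inj_on_ev by (simp add: sum.reindex v_def)
  have "Q_const *\<^sub>R \<delta> (v 0) = 0"
    using F(2) Q_sum_summands[OF v] \<delta>_scale[OF closed_form_in_forms, of "v 0" k Q_const] v[of 0]
    by (simp add: f_sum)
  then have "\<delta> (v 0) = 0" using Q_const_nonzero by simp
  then have "v i \<in> W i" if "i \<in> {0..m}" for i
    using v[OF that] by (auto simp: summand_def H_harm_def H_eig_def closed_forms_def ev_def)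
  then have "v \<in> Pi\<^sub>E {0..m} W"
    by (auto simp: PiE_def v_def)
  then show ?thesis using f_sum by blast
qed

lemma decomposition_unique:
  assumes v: "v \<in> Pi\<^sub>E {0..m} W" and v': "v' \<in> Pi\<^sub>E {0..m} W" and eq: "sum v {0..m} = sum v' {0..m}"
  shows "v = v'"
proof (rule PiE_ext[OF v v'])
  fix i assume i: "i \<in> {0..m}"
  \<comment> \<open>Eigenvectors are indexed here by the eigenvalue instead of its number.\<close>
  define u where "u = (\<lambda>a. v (the_inv_into {0..m} ev a) - v' (the_inv_into {0..m} ev a))"
  have u: "u (ev i) = v i - v' i" if "i \<in> {0..m}" for i
    using the_inv_into_f_f[OF inj_on_ev that] by (simp add: u_def)
  have "u (ev i) \<in> W i" if "i \<in> {0..m}" for i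
    unfolding u[OF that] using v v' that by (intro subspace_diff[OF subspace_summand]) auto
  then have eig: "u a \<in> closed_forms A k \<and> d (\<delta> (u a)) = (- a) *\<^sub>R u a"
    if "a \<in> ev ` {0..m}" for a
    using that summand_eigenvector by blast
  have set_evs: "set (map ev [0..<Suc m]) = ev ` {0..m}"
    by (auto simp: atLeastLessThanSuc_atLeastAtMost simp del: upt_Suc)
  have dist: "distinct (map ev [0..<Suc m])"
    using inj_on_ev by (simp add: distinct_map atLeastLessThanSuc_atLeastAtMost del: upt_Suc)
  have "(\<Sum>a\<in>ev ` {0..m}. u a) = 0"
    using eq u inj_on_ev by (simp add: sum.reindex sum_subtractf)
  then have "u (ev i) = 0"
    using eigenvectors_independent[OF dist, of u, unfolded set_evs, OF eig] i by blast
  then show "v i = v' i" using u[OF i] by simp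
qed

lemma H_G_direct_sum: "direct_sum (H_G A \<delta> J k) {0..m} W"
  unfolding direct_sum_def
proof (intro conjI ballI)
  fix f assume "f \<in> H_G A \<delta> J k"
  then obtain v where v: "v \<in> Pi\<^sub>E {0..m} W" "f = sum v {0..m}"
    using H_G_decomposition by blast
  show "\<exists>!v. v \<in> Pi\<^sub>E {0..m} W \<and> f = sum v {0..m}"
  proof (rule ex1I)
    fix v' assume "v' \<in> Pi\<^sub>E {0..m} W \<and> f = sum v' {0..m}"
    then show "v' = v"
      using v by (intro decomposition_unique) auto
  qed (use v in simp)
qed (use subspace_H_G subspace_summand summand_subset_H_G in auto)

text \<open>On the right only the harmonic part of \<open>w\<close> survives \<open>Q\<close>. On the left the parts \<open>u i\<close> with \<open>i \<ge> 1\<close> are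
  exact and therefore orthogonal to it.\<close>

lemma pairing_Q:
  assumes u: "u \<in> Pi\<^sub>E {0..m} W" and w: "w \<in> Pi\<^sub>E {0..m} W"
  shows "pairing A g \<mu> k (sum u {0..m}) (Q (sum w {0..m})) =
    Q_const * pairing A g \<mu> k (u 0) (w 0)"
proof -
  have eig: "v i \<in> closed_forms A k \<and> d (\<delta> (v i)) = (- ev i) *\<^sub>R v i"
    if "v \<in> Pi\<^sub>E {0..m} W" "i \<in> {0..m}" for v i
    using summand_eigenvector[OF that(2) PiE_mem[OF that]] by blast
  have w0: "w 0 \<in> H_harm A \<delta> k"
    using PiE_mem[OF w, of 0] by (simp add: summand_def)
  have "pairing A g \<mu> k (sum u {0..m}) (w 0) = (\<Sum>i\<in>{0..m}. pairing A g \<mu> k (u i) (w 0))"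
    using eig[OF u] eig[OF w, of 0] by (intro pairing_sum) (auto intro: closed_form_in_forms)
  also have "\<dots> = (\<Sum>i\<in>{0}. pairing A g \<mu> k (u i) (w 0))"
  proof (rule sum.mono_neutral_right)
    show "\<forall>i\<in>{0..m} - {0}. pairing A g \<mu> k (u i) (w 0) = 0"
    proof
      fix i assume i: "i \<in> {0..m} - {0}"
      then have "(- ev i) * pairing A g \<mu> k (u i) (w 0) = 0"
        using pairing_exact_harmonic[OF closed_form_in_forms w0, of "u i"] eig[OF u, of i]
        by (simp add: pairing_scale(1) del: scaleR_minus_left)
      then show "pairing A g \<mu> k (u i) (w 0) = 0"
        using i ev_nonzero[of i] by simp
    qed
  qed auto
  finally show ?thesis
    using Q_sum_summands[OF eig[OF w]] by (simp add: pairing_scale(2))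
qed

lemma projection_image: "sum_projection {0..m} W 0 ` H_G A \<delta> J k = H_harm A \<delta> k"
proof
  show "sum_projection {0..m} W 0 ` H_G A \<delta> J k \<subseteq> H_harm A \<delta> k"
  proof
    fix h assume "h \<in> sum_projection {0..m} W 0 ` H_G A \<delta> J k"
    then obtain v where "v \<in> Pi\<^sub>E {0..m} W" "h = sum_projection {0..m} W 0 (sum v {0..m})"
      using H_G_decomposition by blast
    then have "h \<in> W 0" using sum_projectionI[OF H_G_direct_sum] by auto
    then show "h \<in> H_harm A \<delta> k" by (simp add: summand_def)
  qed
  show "H_harm A \<delta> k \<subseteq> sum_projection {0..m} W 0 ` H_G A \<delta> J k"
  proof
    fix h assume h: "h \<in> H_harm A \<delta> k"
    define v where "v = (\<lambda>i\<in>{0..m}. if i = 0 then h else 0)"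
    have v: "v \<in> Pi\<^sub>E {0..m} W"
    proof -
      have "(if i = 0 then h else 0) \<in> W i" for i
        using h subspace_0[OF subspace_summand, of i] by (cases "i = 0") (simp_all add: summand_def)
      then show ?thesis by (simp add: v_def PiE_def)
    qed
    from sum_projectionI(1)[OF H_G_direct_sum v] sum_projectionI(2)[OF H_G_direct_sum v, of 0]
    show "h \<in> sum_projection {0..m} W 0 ` H_G A \<delta> J k"
      by (intro image_eqI[of _ _ "sum v {0..m}"]) (simp_all add: v_def)
  qed
qed

lemma pairing_Q_descends:
  "descends_via (sum_projection {0..m} W 0) (H_G A \<delta> J k) (H_harm A \<delta> k)
    (\<lambda>u w. pairing A g \<mu> k u (Q w)) (\<lambda>u w. Q_const * pairing A g \<mu> k u w)"
  unfolding descends_via_def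
proof (intro conjI ballI)
  show "sum_projection {0..m} W 0 ` H_G A \<delta> J k = H_harm A \<delta> k"
    by (rule projection_image)
  fix u w assume "u \<in> H_G A \<delta> J k" "w \<in> H_G A \<delta> J k"
  then obtain u' w' where "u' \<in> Pi\<^sub>E {0..m} W" "u = sum u' {0..m}"
    "w' \<in> Pi\<^sub>E {0..m} W" "w = sum w' {0..m}"
    using H_G_decomposition by meson
  then show "pairing A g \<mu> k u (Q w) = Q_const *
      pairing A g \<mu> k (sum_projection {0..m} W 0 u) (sum_projection {0..m} W 0 w)"
    using pairing_Q sum_projectionI(2)[OF H_G_direct_sum] by simp
qed

end

theorem proposition6p2:
  fixes A :: "('a::{t2_space, second_countable_topology}, 'n::finite) chart set"
    and g :: "('a, 'n) metric_field"
    and \<mu> :: "'a measure"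
    and \<delta> :: "('a, 'n) field \<Rightarrow> ('a, 'n) field"
    and J :: real
    and k :: nat
  defines "m \<equiv> (CARD('n) - 2 * k) div 2"
  assumes "even CARD('n)" and "CARD('n) \<ge> 4"
    and "smooth_atlas A" and "compact (UNIV :: 'a set)"
    and "pseudo_riemannian_metric A g"
    and "einstein A g" and "\<not> ricci_flat A g"
    and "\<forall>c\<in>A. \<forall>p\<in>chart_dom c. schouten_trace g c p = J"
    and "volume_measure A g \<mu>"
    and "codifferential A g \<mu> \<delta>"
    and "k \<le> CARD('n) div 2"
  shows "direct_sum (H_G A \<delta> J k) {0..m} (summand A \<delta> J k) \<and>
    descends_via (sum_projection {0..m} (summand A \<delta> J k) 0) (H_G A \<delta> J k) (H_harm A \<delta> k)
      (\<lambda>u w. pairing A g \<mu> k u (Q_op A \<delta> J k w))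
      (\<lambda>u w. (\<Prod>i=1..m. coef CARD('n) k i) * J ^ m * pairing A g \<mu> k u w)"
proof -
  have "J \<noteq> 0"
    using assms by (intro schouten_trace_nonzero[where A = A and g = g]) auto
  then interpret S: nonzero_schouten A g \<mu> \<delta> J k
    using assms by unfold_locales auto
  show ?thesis
    using S.H_G_direct_sum S.pairing_Q_descends
    unfolding S.Q_const_def S.m_def m_def by blast
qed

end
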